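(* There is an absolute constant $c>0$ such that for all integers $n\ge k\ge 1$ and every integer $m\ge (cn/k)^c$, there exists a $k\times n$ matrix with integer entries in $\{-m,\ldots,m\}$ which is an MDS matrix, i.e. every $k\times k$ submatrix formed by choosing $k$ of its columns is nonsingular (over $\mathbb{R}$).
   Context: A $k\times n$ matrix ($n\ge k$) is called an MDS matrix if any $k$ of its columns are linearly independent, equivalently every $k\times k$ minor is nonzero. $c$ does not depend on $n,k,m$. *)

theory Defs
  imports "HOL-Analysis.Analysis"
begin

definition det_nat :: "nat \<Rightarrow> (nat \<Rightarrow> nat \<Rightarrow> real) \<Rightarrow> real" where
  "det_nat k B = (\<Sum>p | p permutes {..<k}. of_int (sign p) * (\<Prod>i<k. B i (p i)))"

definition MDS :: "nat \<Rightarrow> nat \<Rightarrow> (nat \<Rightarrow> nat \<Rightarrow> int) \<Rightarrow> bool" where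
  "MDS k n A \<longleftrightarrow> (\<forall>c :: nat \<Rightarrow> nat.
      strict_mono_on {..<k} c \<and> c ` {..<k} \<subseteq> {..<n} \<longrightarrow>
      det_nat k (\<lambda>i j. real_of_int (A i (c j))) \<noteq> 0)"

end

theory Submission
  imports Defs "HOL-Library.Function_Algebras" "HOL-Probability.Product_PMF"
    "Jordan_Normal_Form.Determinant"
begin

text \<open>
  Take $2n$ independent random columns whose entries are lazy random walks of length
  $2 r^6$, where $r$ is polynomial in $n/k$. If all columns together have rank $k$ and no $k$ of them
  have rank exactly $k - 1$, then exchanging columns shows that any $k$ of them are independent. By
  the union bound it remains to show that $k$ columns span a hyperplane with probability at most
  $(C/r)^{ck}$.

  This is the method of Kahn, Komlos and Szemeredi. Hyperplanes with a sparse normal vector and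
  hyperplanes $V$ with $p(V) = P(X \in V)$ tiny are handled by union bounds, using that a subspace of
  dimension $d$ contains a column with probability at most $\rho^{k-d}$, where $\rho$ is the largest
  point mass of an entry. For the other $V$, let $Y$ be a column of shorter and lazier walks. The
  Fourier transforms of $X$ and $Y$ are bounded by, respectively bound, Gaussians in the
  subadditive distance of $\xi a / N$ from the lattice, with $a$ the normal of $V$, so that a growth
  estimate for its sublevel sets gives $p(V) = O(1/r) P(Y \in V)$. Replacing $k/2$ of the columns $X$
  by columns $Y$ in the event that the columns span $V$ gains a factor $O(1/r)^{k/2}$, and the
  resulting probabilities sum to at most $1$ over all $V$ for each choice of the replaced columns.
\<close>

section \<open>Linear algebra of finitely supported real vectors\<close>

text \<open>The comparison of Fourier sums treats a single linear equation, hence hyperplanes only.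
  This is why rank exactly k - 1 is singled out, smaller ranks being left to the exchange of
  columns.

  The swap uses only half of the columns. It needs d independent columns Y inside V, so a subspace
  of dimension below d must be clearly less likely to contain Y than V is; as such a subspace is
  controlled only by \<rho>^(k - d), hyperplanes V below that threshold need a separate bound, and d
  = k/2 balances the two. The total is thus about \<rho>^(k/2), and it has to beat the (6n/k)^k
  coming from the choice of k out of 2n columns; \<rho> of order (k/n)^3 does so for every k \<ge>
  2.

  The lengths answer two demands. The estimate for point masses yields \<rho> for the lazier walk
  from 2 r^4 steps on. The walk of X has r^2 times as many steps because Gaussian factors whose
  exponents differ by r^2 have superlevel sets whose radii differ by r, and the growth estimate
  turns the ratio r of the radii into a gain of order r in the count of frequencies.\<close>

definition vscale :: "real \<Rightarrow> (nat \<Rightarrow> real) \<Rightarrow> nat \<Rightarrow> real" where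
  "vscale c f = (\<lambda>i. c * f i)"

lemma vscale_apply: "vscale c f i = c * f i"
  by (simp add: vscale_def)

global_interpretation vs: vector_space vscale
  by unfold_locales (auto simp: vscale_def fun_eq_iff algebra_simps)

text \<open>Since k varies, coordinate spaces are subspaces of one space of functions: this is
  R^I.\<close>

definition vecs :: "nat set \<Rightarrow> (nat \<Rightarrow> real) set" where
  "vecs I = {f. \<forall>i. i \<notin> I \<longrightarrow> f i = 0}"

lemma subspace_vecs: "vs.subspace (vecs I)"
  by (auto simp: vs.subspace_def vecs_def vscale_apply)

lemma sum_fun_apply: "(\<Sum>a\<in>A. f a) x = (\<Sum>a\<in>A. f a x)" for f :: "'a \<Rightarrow> 'b \<Rightarrow> 'c::comm_monoid_add"
  by (induction A rule: infinite_finite_induct) auto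

lemma independent_in_vecs:
  assumes "finite I" "S \<subseteq> vecs I" "vs.independent S"
  shows "finite S \<and> card S \<le> card I"
proof -
  define e where "e i = (\<lambda>j::nat. if j = i then 1 else 0 :: real)" for i
  have "f \<in> vs.span (e ` I)" if "f \<in> vecs I" for f
  proof -
    have "f = (\<Sum>i\<in>I. vscale (f i) (e i))"
      using that assms(1) by (auto simp: fun_eq_iff sum_fun_apply e_def vecs_def vscale_apply if_distrib cong: if_cong)
    also have "\<dots> \<in> vs.span (e ` I)"
      by (intro vs.span_sum vs.span_scale vs.span_base) auto
    finally show ?thesis .
  qed
  with assms have "finite S \<and> card S \<le> card (e ` I)"
    by (intro vs.independent_span_bound) auto
  with assms(1) show ?thesis
    using card_image_le[of I e] by linarith
qed

lemma subspace_orth: "vs.subspace {v. (\<Sum>i\<in>I. a i * v i) = 0}" for a :: "nat \<Rightarrow> real"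
  by (auto simp: vs.subspace_def vscale_apply distrib_left sum.distrib mult.left_commute[of "a _"]
      simp flip: sum_distrib_left)

text \<open>The vector a, cut off outside I, is not orthogonal to itself, while all of the span of S
  is orthogonal to it. It can therefore be adjoined to S, which makes the bound
  \<open>card I\<close> strict for S.\<close>

lemma independent_orth:
  fixes a :: "nat \<Rightarrow> real"
  assumes "finite I" "S \<subseteq> vecs I" "vs.independent S"
    and orth: "\<And>v. v \<in> S \<Longrightarrow> (\<Sum>i\<in>I. a i * v i) = 0"
    and a: "i \<in> I" "a i \<noteq> 0"
  shows "finite S \<and> card S < card I"
proof -
  define a' where "a' = (\<lambda>i. if i \<in> I then a i else 0)"
  have "vs.span S \<subseteq> {v. (\<Sum>i\<in>I. a i * v i) = 0}"
    using orth by (intro vs.span_minimal subspace_orth) auto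
  moreover have "(\<Sum>i\<in>I. a i * a' i) = (\<Sum>i\<in>I. (a i)\<^sup>2)"
    by (intro sum.cong) (auto simp: a'_def power2_eq_square)
  moreover have "(\<Sum>i\<in>I. (a i)\<^sup>2) > 0"
    using assms(1) a by (intro sum_pos2[of I i]) auto
  ultimately have na: "a' \<notin> vs.span S"
    by auto
  hence "vs.independent (insert a' S)"
    using assms(3) by (intro vs.independent_insertI)
  moreover have "insert a' S \<subseteq> vecs I"
    using assms(2) by (auto simp: a'_def vecs_def)
  ultimately have "finite (insert a' S) \<and> card (insert a' S) \<le> card I"
    using assms(1) by (intro independent_in_vecs)
  moreover have "a' \<notin> S"
    using na vs.span_base by blast
  ultimately show ?thesis
    by auto
qed

text \<open>The set I consists of pivots. A new generator t costs at most one more: if some z in the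
  larger span vanishes on I but not everywhere, a coordinate i with \<open>z i \<noteq> 0\<close> is
  added.\<close>

lemma span_determined_by_coordinates:
  assumes "finite T"
  shows "\<exists>I. finite I \<and> card I \<le> card T \<and> (\<forall>x\<in>vs.span T. (\<forall>i\<in>I. x i = 0) \<longrightarrow> (\<forall>i. x i = 0))"
  using assms
proof (induction T rule: finite_induct)
  case empty
  show ?case by (intro exI[of _ "{}"]) (auto simp: vs.span_empty)
next
  case (insert t T)
  then obtain I where I: "finite I" "card I \<le> card T"
    "\<And>x. x \<in> vs.span T \<Longrightarrow> (\<forall>i\<in>I. x i = 0) \<Longrightarrow> (\<forall>i. x i = 0)" by metis
  show ?case
  proof (cases "\<forall>x\<in>vs.span (insert t T). (\<forall>i\<in>I. x i = 0) \<longrightarrow> (\<forall>i. x i = 0)")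
    case True
    with I(1,2) insert(1,2) show ?thesis by (intro exI[of _ I] conjI) simp_all
  next
    case False
    then obtain z i where z: "z \<in> vs.span (insert t T)" "\<forall>i\<in>I. z i = 0" "z i \<noteq> 0"
      by auto
    then obtain \<alpha> where \<alpha>: "z - vscale \<alpha> t \<in> vs.span T"
      by (auto simp: vs.span_breakdown_eq)
    have "\<alpha> \<noteq> 0"
    proof
      assume "\<alpha> = 0"
      hence "z \<in> vs.span T" using \<alpha> by simp
      thus False using I(3)[of z] z by auto
    qed
    have vanish: "\<forall>i. x i = 0" if x: "x \<in> vs.span (insert t T)" "\<forall>l\<in>insert i I. x l = 0" for x
    proof -
      obtain \<beta> where \<beta>: "x - vscale \<beta> t \<in> vs.span T"
        using x by (auto simp: vs.span_breakdown_eq)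
      \<comment> \<open>The multiples of t cancel, so x minus a multiple of z lies in the old span
        and vanishes on I, hence is 0; the coordinate i then forces the multiple to be 0.\<close>
      have "(x - vscale \<beta> t) - vscale (\<beta> / \<alpha>) (z - vscale \<alpha> t) \<in> vs.span T"
        by (rule vs.span_diff[OF \<beta> vs.span_scale[OF \<alpha>]])
      also have "(x - vscale \<beta> t) - vscale (\<beta> / \<alpha>) (z - vscale \<alpha> t) = x - vscale (\<beta> / \<alpha>) z"
        using \<open>\<alpha> \<noteq> 0\<close> by (auto simp: fun_eq_iff vscale_apply field_simps)
      finally have mem: "x - vscale (\<beta> / \<alpha>) z \<in> vs.span T" .
      have "\<forall>l. (x - vscale (\<beta> / \<alpha>) z) l = 0"
        by (rule I(3)[OF mem]) (use x z in \<open>auto simp: vscale_apply\<close>)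
      hence eq: "x l = \<beta> / \<alpha> * z l" for l
        by (auto simp: vscale_apply)
      from eq[of i] x(2) z(3) have "\<beta> / \<alpha> = 0" by auto
      with eq show ?thesis by simp
    qed
    have "card (insert i I) \<le> card (insert t T)"
      using I(1,2) insert(1,2) by (simp add: card_insert_if)
    with I(1) vanish show ?thesis
      by (intro exI[of _ "insert i I"] conjI ballI impI) (simp, assumption, metis)
  qed
qed

section \<open>Integer normals of hyperplanes\<close>

definition rvec :: "(nat \<Rightarrow> int) \<Rightarrow> nat \<Rightarrow> real" where
  "rvec x = (\<lambda>i. real_of_int (x i))"

text \<open>The normal is integral so that its product with an integer column is an integer random
  variable, open to Fourier inversion modulo N. Hyperplanes spanned by integer vectors are of this
  form, see \<open>span_eq_hyp\<close>.\<close>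

definition hyp :: "nat \<Rightarrow> (nat \<Rightarrow> int) \<Rightarrow> (nat \<Rightarrow> real) set" where
  "hyp k a = {v \<in> vecs {..<k}. (\<Sum>i<k. real_of_int (a i) * v i) = 0}"

lemma rvec_in_hyp_iff:
  assumes "rvec x \<in> vecs {..<k}"
  shows "rvec x \<in> hyp k a \<longleftrightarrow> (\<Sum>i<k. a i * x i) = 0"
proof -
  have "(\<Sum>i<k. real_of_int (a i) * rvec x i) = real_of_int (\<Sum>i<k. a i * x i)"
    by (simp add: rvec_def)
  with assms show ?thesis
    unfolding hyp_def by (simp only: mem_Collect_eq of_int_eq_0_iff) simp
qed

lemma subspace_hyp: "vs.subspace (hyp k a)"
proof -
  have "hyp k a = vecs {..<k} \<inter> {v. (\<Sum>i<k. real_of_int (a i) * v i) = 0}"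
    by (auto simp: hyp_def)
  thus ?thesis using vs.subspace_inter[OF subspace_vecs subspace_orth] by simp
qed

text \<open>Over an integral domain a vanishing determinant yields a kernel vector over the same
  domain, so the normal is integral with no denominators to clear.\<close>

lemma singular_int_matrix:
  fixes M :: "nat \<Rightarrow> nat \<Rightarrow> int"
  assumes "Determinant.det (Matrix.mat k k (\<lambda>(j,i). M j i)) = 0"
  shows "\<exists>a. (\<forall>i\<ge>k. a i = 0) \<and> (\<exists>i<k. a i \<noteq> 0) \<and> (\<forall>j<k. (\<Sum>i<k. a i * M j i) = 0)"
proof -
  let ?A = "Matrix.mat k k (\<lambda>(j,i). M j i)"
  have "?A \<in> carrier_mat k k" by simp
  then obtain v where v: "v \<in> carrier_vec k" "v \<noteq> 0\<^sub>v k" "?A *\<^sub>v v = 0\<^sub>v k"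
    using assms det_0_iff_vec_prod_zero by blast
  define a where "a i = (if i < k then vec_index v i else 0)" for i
  have "\<exists>i<k. a i \<noteq> 0"
  proof (rule ccontr)
    assume "\<not> ?thesis"
    hence "v = 0\<^sub>v k" using v by (intro eq_vecI) (auto simp: a_def split: if_splits)
    with v show False by simp
  qed
  moreover have "(\<Sum>i<k. a i * M j i) = 0" if "j < k" for j
  proof -
    have "vec_index (?A *\<^sub>v v) j = (\<Sum>i<k. M j i * vec_index v i)"
      using that v(1) by (auto simp: scalar_prod_def atLeast0LessThan)
    also have "\<dots> = (\<Sum>i<k. a i * M j i)"
      by (intro sum.cong) (auto simp: a_def)
    finally show ?thesis using v(3) that by simp
  qed
  ultimately show ?thesis by (intro exI[of _ a]) (auto simp: a_def)
qed

lemma orth_columns_of_det_nat_0: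
  fixes M :: "nat \<Rightarrow> nat \<Rightarrow> int"
  assumes "det_nat k (\<lambda>i j. real_of_int (M i j)) = 0"
  shows "\<exists>a. (\<forall>i\<ge>k. a i = 0) \<and> (\<exists>i<k. a i \<noteq> 0) \<and> (\<forall>j<k. (\<Sum>i<k. a i * M i j) = 0)"
proof -
  let ?A = "Matrix.mat k k (\<lambda>(i,j). M i j)"
  have "det_nat k (\<lambda>i j. real_of_int (M i j)) = real_of_int (Determinant.det ?A)"
    unfolding det_nat_def Determinant.det_def
    by (auto simp: atLeast0LessThan permutes_in_image intro!: sum.cong prod.cong)
  hence "Determinant.det ?A = 0" using assms by simp
  hence "Determinant.det (transpose_mat ?A) = 0"
    by (subst det_transpose) auto
  also have "transpose_mat ?A = Matrix.mat k k (\<lambda>(j,i). M i j)"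
    by auto
  finally show ?thesis by (intro singular_int_matrix)
qed

text \<open>Padding with zero rows gives a singular k by k matrix: its transpose annihilates the
  unit vector at \<open>card F\<close>, the first padded row.\<close>

lemma exists_int_normal:
  assumes "finite F" "card F < k"
  shows "\<exists>a. (\<forall>i\<ge>k. a i = 0) \<and> (\<exists>i<k. a i \<noteq> 0) \<and> (\<forall>f\<in>F. (\<Sum>i<k. a i * (f i :: int)) = 0)"
proof -
  obtain g where g: "g ` {..<card F} = F"
    using assms(1) by (metis bij_betw_imp_surj_on ex_bij_betw_nat_finite atLeast0LessThan)
  define M where "M j i = (if j < card F then g j i else 0)" for j i
  let ?A = "Matrix.mat k k (\<lambda>(j,i). M j i)"
  have "row ?A (card F) = 0\<^sub>v k"
    using assms by (intro eq_vecI) (auto simp: M_def)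
  hence "transpose_mat ?A *\<^sub>v unit_vec k (card F) = 0\<^sub>v k"
    using assms by (intro eq_vecI) (auto simp: M_def)
  moreover have "unit_vec k (card F) \<noteq> (0\<^sub>v k :: int Matrix.vec)"
    using assms by (auto simp: vec_eq_iff)
  ultimately have "Determinant.det (transpose_mat ?A) = 0"
    by (subst det_0_iff_vec_prod_zero[of _ k]) (auto intro!: exI[of _ "unit_vec k (card F)"])
  hence "Determinant.det ?A = 0"
    by (subst (asm) det_transpose) auto
  from singular_int_matrix[OF this] obtain a where a:
    "\<forall>i\<ge>k. a i = 0" "\<exists>i<k. a i \<noteq> 0" "\<And>j. j < k \<Longrightarrow> (\<Sum>i<k. a i * M j i) = 0" by blast
  have "(\<Sum>i<k. a i * f i) = 0" if "f \<in> F" for f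
  proof -
    from that g obtain j where "j < card F" "f = g j" by auto
    with a(3)[of j] assms show ?thesis by (simp add: M_def)
  qed
  with a show ?thesis by blast
qed

text \<open>Equality holds by dimension: a vector of the hyperplane outside the span would give k
  independent vectors orthogonal to a, against \<open>independent_orth\<close>.\<close>

lemma span_eq_hyp:
  assumes B: "B \<subseteq> vecs {..<k}" "vs.independent B" "card B = k - 1" "k \<ge> 1" "B \<subseteq> range rvec"
  shows "\<exists>a. (\<forall>i\<ge>k. a i = 0) \<and> (\<exists>i<k. a i \<noteq> 0) \<and> vs.span B = hyp k a"
proof -
  have fin: "finite B" using independent_in_vecs[of "{..<k}" B] B by auto
  obtain F where F: "F \<subseteq> UNIV" "inj_on rvec F" "B = rvec ` F"
    using B(5) by (meson subset_image_inj)
  have "finite F" "card F < k"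
    using F fin B by (auto simp: card_image finite_image_iff)
  from exists_int_normal[OF this] obtain a where a: "\<forall>i\<ge>k. a i = 0" "\<exists>i<k. a i \<noteq> 0"
    "\<And>f. f \<in> F \<Longrightarrow> (\<Sum>i<k. a i * f i) = 0" by blast
  have sub: "B \<subseteq> hyp k a"
    using B(1) F(3) a(3) by (auto simp: rvec_in_hyp_iff)
  have "vs.span B \<subseteq> hyp k a"
    by (intro vs.span_minimal sub subspace_hyp)
  moreover have "x \<in> vs.span B" if x: "x \<in> hyp k a" for x
  proof (rule ccontr)
    assume nx: "x \<notin> vs.span B"
    from a(2) obtain i where i: "i < k" "a i \<noteq> 0" by blast
    have "vs.independent (insert x B)"
      using nx B by (intro vs.independent_insertI)
    hence "card (insert x B) < card {..<k}"
      using sub x i independent_orth[of "{..<k}" "insert x B" "\<lambda>i. real_of_int (a i)" i]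
      by (auto simp: hyp_def)
    moreover have "x \<notin> B" using nx vs.span_base by blast
    ultimately show False using B fin by simp
  qed
  ultimately show ?thesis using a(1,2) by blast
qed

section \<open>Rank of random integer families\<close>

lemma prob_pair_pmf:
  assumes "finite (set_pmf A)"
  shows "measure_pmf.prob (pair_pmf A B) {(x, y). R x y} =
    (\<Sum>x\<in>set_pmf A. pmf A x * measure_pmf.prob B {y. R x y})"
proof -
  have "emeasure (pair_pmf A B) {(x, y). R x y} =
      (\<integral>\<^sup>+ z. indicator {(x, y). R x y} z \<partial>pair_pmf A B)"
    by simp
  also have "\<dots> = (\<integral>\<^sup>+ x. \<integral>\<^sup>+ y. indicator {(x, y). R x y} (x, y) \<partial>B \<partial>A)"
    by (rule nn_integral_pair_pmf')
  also have "\<dots> = (\<integral>\<^sup>+ x. \<integral>\<^sup>+ y. indicator {y. R x y} y \<partial>B \<partial>A)"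
    by (intro nn_integral_cong) (auto simp: indicator_def)
  also have "\<dots> = (\<integral>\<^sup>+ x. ennreal (measure_pmf.prob B {y. R x y}) \<partial>A)"
    by (simp add: measure_pmf.emeasure_eq_measure)
  also have "\<dots> = (\<Sum>x\<in>set_pmf A. ennreal (measure_pmf.prob B {y. R x y}) * pmf A x)"
    using assms by (intro nn_integral_measure_pmf_finite) auto
  also have "\<dots> = ennreal (\<Sum>x\<in>set_pmf A. pmf A x * measure_pmf.prob B {y. R x y})"
    by (subst sum_ennreal[symmetric]) (auto simp: ennreal_mult'' mult.commute)
  finally show ?thesis
    by (simp add: measure_pmf.emeasure_eq_measure sum_nonneg)
qed

lemma prob_pair_pmf_le:
  assumes "finite (set_pmf A)"
    and "\<And>x. x \<in> set_pmf A \<Longrightarrow> Q x \<Longrightarrow> measure_pmf.prob B {y. R x y} \<le> c"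
  shows "measure_pmf.prob (pair_pmf A B) {(x, y). Q x \<and> R x y} \<le> measure_pmf.prob A {x. Q x} * c"
proof -
  have "measure_pmf.prob (pair_pmf A B) {(x, y). Q x \<and> R x y} =
      (\<Sum>x\<in>set_pmf A. pmf A x * measure_pmf.prob B {y. Q x \<and> R x y})"
    using assms(1) by (rule prob_pair_pmf)
  also have "\<dots> = (\<Sum>x\<in>{x\<in>set_pmf A. Q x}. pmf A x * measure_pmf.prob B {y. R x y})"
    using assms(1) by (intro sum.mono_neutral_cong_right) auto
  also have "\<dots> \<le> (\<Sum>x\<in>{x\<in>set_pmf A. Q x}. pmf A x * c)"
    using assms(2) by (intro sum_mono mult_left_mono) auto
  also have "\<dots> = measure_pmf.prob A {x\<in>set_pmf A. Q x} * c"
    using assms(1) by (subst measure_measure_pmf_finite) (auto simp: sum_distrib_right)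
  also have "measure_pmf.prob A {x\<in>set_pmf A. Q x} = measure_pmf.prob A {x. Q x}"
    by (intro measure_pmf.finite_measure_eq_AE) (auto simp: AE_measure_pmf_iff)
  finally show ?thesis .
qed

lemma prob_pair_pmf_ge:
  assumes "finite (set_pmf A)"
    and "\<And>x. x \<in> set_pmf A \<Longrightarrow> Q x \<Longrightarrow> measure_pmf.prob B {y. R x y} \<ge> c"
  shows "measure_pmf.prob (pair_pmf A B) {(x, y). Q x \<and> R x y} \<ge> measure_pmf.prob A {x. Q x} * c"
proof -
  have "measure_pmf.prob A {x. Q x} * c = measure_pmf.prob A {x\<in>set_pmf A. Q x} * c"
    by (intro arg_cong2[of _ _ _ _ "(*)"] measure_pmf.finite_measure_eq_AE) (auto simp: AE_measure_pmf_iff)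
  also have "\<dots> = (\<Sum>x\<in>{x\<in>set_pmf A. Q x}. pmf A x * c)"
    using assms(1) by (subst measure_measure_pmf_finite) (auto simp: sum_distrib_right)
  also have "\<dots> \<le> (\<Sum>x\<in>{x\<in>set_pmf A. Q x}. pmf A x * measure_pmf.prob B {y. R x y})"
    using assms(2) by (intro sum_mono mult_left_mono) auto
  also have "\<dots> = (\<Sum>x\<in>set_pmf A. pmf A x * measure_pmf.prob B {y. Q x \<and> R x y})"
    using assms(1) by (intro sum.mono_neutral_cong_left) auto
  also have "\<dots> = measure_pmf.prob (pair_pmf A B) {(x, y). Q x \<and> R x y}"
    using assms(1) by (rule prob_pair_pmf[symmetric])
  finally show ?thesis .
qed

lemma prob_le_of_unique:
  assumes "\<And>x y. x \<in> set_pmf M \<Longrightarrow> y \<in> set_pmf M \<Longrightarrow> x \<in> A \<Longrightarrow> y \<in> A \<Longrightarrow> x = y"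
    and "\<And>x. pmf M x \<le> c"
  shows "measure_pmf.prob M A \<le> c"
proof (cases "A \<inter> set_pmf M = {}")
  case True
  hence "measure_pmf.prob M A = 0"
    by (auto simp: measure_pmf_zero_iff)
  also have "0 \<le> c" using assms(2)[of undefined] pmf_nonneg[of M undefined] by linarith
  finally show ?thesis .
next
  case False
  then obtain z where z: "z \<in> A" "z \<in> set_pmf M" by auto
  have "measure_pmf.prob M A = measure_pmf.prob M {z}"
    using assms(1) z by (intro measure_pmf.finite_measure_eq_AE) (auto simp: AE_measure_pmf_iff)
  thus ?thesis using assms(2) by (simp add: measure_pmf_single)
qed

lemma finite_set_Pi_pmf:
  "finite A \<Longrightarrow> finite (set_pmf p) \<Longrightarrow> finite (set_pmf (Pi_pmf A d (\<lambda>_. p)))"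
  by (simp add: set_Pi_pmf finite_PiE_dflt)

lemma prob_Pi_pmf_split:
  assumes "finite T" "finite D" "T \<inter> D = {}" "T \<union> D = J"
  shows "measure_pmf.prob (Pi_pmf J d p) E =
    measure_pmf.prob (pair_pmf (Pi_pmf T d p) (Pi_pmf D d p))
      {(f, g). (\<lambda>x. if x \<in> T then f x else g x) \<in> E}"
  using Pi_pmf_union[OF assms(1-3), of d p] assms(4)
  by (simp add: vimage_def case_prod_unfold)

section \<open>Random columns in small subspaces\<close>

definition restr :: "nat set \<Rightarrow> (nat \<Rightarrow> int) \<Rightarrow> nat \<Rightarrow> int" where
  "restr I x = (\<lambda>i. if i \<in> I then x i else 0)"

text \<open>Odlyzko's bound: once the determining coordinates, at most \<open>card T\<close> of
  them, are revealed, at most one choice of the others leads into the span, and its mass is at most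
  \<rho> per coordinate.\<close>

lemma prob_in_span_le:
  fixes p :: "int pmf"
  assumes fin: "finite I" "finite T" "finite (set_pmf p)"
    and rho: "\<And>z. pmf p z \<le> \<rho>" "\<rho> \<le> 1"
  shows "measure_pmf.prob (Pi_pmf I 0 (\<lambda>_. p)) {x. rvec x \<in> vs.span T} \<le> \<rho> ^ (card I - card T)"
proof -
  have rho0: "0 \<le> \<rho>" using rho(1)[of 0] pmf_nonneg[of p 0] by linarith
  obtain I' where I': "finite I'" "card I' \<le> card T"
    "\<And>x. x \<in> vs.span T \<Longrightarrow> (\<forall>i\<in>I'. x i = 0) \<Longrightarrow> (\<forall>i. x i = 0)"
    using span_determined_by_coordinates[OF fin(2)] by metis
  define J where "J = I' \<inter> I"
  define D where "D = I - J"
  have JD: "finite J" "finite D" "J \<inter> D = {}" "J \<union> D = I"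
    using fin by (auto simp: J_def D_def)
  have "card J \<le> card T"
    using I' card_mono[of I' J] by (auto simp: J_def)
  hence cD: "card I - card T \<le> card D"
    using card_Un_disjoint[OF JD(1-3)] JD(4) by simp
  let ?g = "\<lambda>(f::nat\<Rightarrow>int) g x. if x \<in> J then f x else g x"
  have "measure_pmf.prob (Pi_pmf I 0 (\<lambda>_. p)) {x. rvec x \<in> vs.span T} =
      measure_pmf.prob (pair_pmf (Pi_pmf J 0 (\<lambda>_. p)) (Pi_pmf D 0 (\<lambda>_. p)))
        {(f, g). True \<and> rvec (?g f g) \<in> vs.span T}"
    by (subst prob_Pi_pmf_split[OF JD]) (simp add: case_prod_unfold)
  also have "\<dots> \<le> measure_pmf.prob (Pi_pmf J 0 (\<lambda>_. p)) {f. True} * \<rho> ^ card D"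
  proof (rule prob_pair_pmf_le)
    show "finite (set_pmf (Pi_pmf J 0 (\<lambda>_. p)))"
      using JD fin by (intro finite_set_Pi_pmf)
    fix f assume "f \<in> set_pmf (Pi_pmf J 0 (\<lambda>_. p))"
    show "measure_pmf.prob (Pi_pmf D 0 (\<lambda>_. p)) {g. rvec (?g f g) \<in> vs.span T} \<le> \<rho> ^ card D"
    proof (rule prob_le_of_unique)
      fix g h assume gh: "g \<in> set_pmf (Pi_pmf D 0 (\<lambda>_. p))" "h \<in> set_pmf (Pi_pmf D 0 (\<lambda>_. p))"
        "g \<in> {g. rvec (?g f g) \<in> vs.span T}" "h \<in> {g. rvec (?g f g) \<in> vs.span T}"
      have out: "g i = 0 \<and> h i = 0" if "i \<notin> D" for i
        using gh(1,2) set_Pi_pmf_subset[OF JD(2), of 0 "\<lambda>_. p"] that by auto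
      have "\<forall>i. (rvec (?g f g) - rvec (?g f h)) i = 0"
      proof (rule I'(3))
        show "rvec (?g f g) - rvec (?g f h) \<in> vs.span T"
          using gh by (intro vs.span_diff) auto
        show "\<forall>i\<in>I'. (rvec (?g f g) - rvec (?g f h)) i = 0"
          using out by (auto simp: rvec_def J_def D_def)
      qed
      hence eq: "?g f g i = ?g f h i" for i
        by (auto simp: rvec_def)
      show "g = h"
      proof
        fix i show "g i = h i"
          using eq[of i] out[of i] by (cases "i \<in> D") (auto simp: D_def split: if_splits)
      qed
    next
      fix g show "pmf (Pi_pmf D 0 (\<lambda>_. p)) g \<le> \<rho> ^ card D"
        using JD(2) rho rho0
        by (auto simp: pmf_Pi prod_constant[symmetric] simp del: prod_constant intro!: prod_mono prod_nonneg)
    qed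
  qed
  also have "\<dots> \<le> \<rho> ^ (card I - card T)"
    using cD rho rho0 by (simp add: power_decreasing)
  finally show ?thesis .
qed

lemma prob_restr_in_span_le:
  fixes p :: "int pmf"
  assumes fin: "finite K" "I \<subseteq> K" "finite T" "finite (set_pmf p)"
    and rho: "\<And>z. pmf p z \<le> \<rho>" "\<rho> \<le> 1"
  shows "measure_pmf.prob (Pi_pmf K 0 (\<lambda>_. p)) {x. rvec (restr I x) \<in> vs.span T} \<le> \<rho> ^ (card I - card T)"
proof -
  have "measure_pmf.prob (Pi_pmf I 0 (\<lambda>_. p)) {x. rvec x \<in> vs.span T} =
    measure_pmf.prob (Pi_pmf K 0 (\<lambda>_. p)) {x. rvec (restr I x) \<in> vs.span T}"
    using fin by (subst Pi_pmf_subset[of K I]) (auto simp: vimage_def restr_def)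
  moreover have "finite I" using fin finite_subset by blast
  ultimately show ?thesis using prob_in_span_le[of I T p \<rho>] fin rho by simp
qed

text \<open>If the rank is below \<open>card I\<close>, fewer than \<open>card I\<close> columns,
  indexed by some T, already span all of them. Each of the others, at least
  \<open>card J - card I\<close> many, then lies in a proper subspace, at cost \<rho>. The choice of
  T costs \<open>2 ^ card J\<close>. Applied both to the full family and, with I the support of a
  normal, to sparse hyperplanes.\<close>

lemma prob_rank_deficient_le:
  fixes p :: "int pmf"
  assumes fin: "finite K" "I \<subseteq> K" "finite J" "finite (set_pmf p)"
    and rho: "\<And>z. pmf p z \<le> \<rho>" "\<rho> \<le> 1"
  shows "measure_pmf.prob (Pi_pmf J d (\<lambda>_. Pi_pmf K 0 (\<lambda>_. p)))
      {x. vs.dim ((\<lambda>j. rvec (restr I (x j))) ` J) < card I} \<le> 2 ^ card J * \<rho> ^ (card J - card I)"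
    (is "measure_pmf.prob ?M ?E \<le> _")
proof -
  have rho0: "0 \<le> \<rho>" using rho(1)[of 0] pmf_nonneg[of p 0] by linarith
  define r where "r x = rvec (restr I x)" for x
  let ?col = "Pi_pmf K 0 (\<lambda>_. p)"
  define TT where "TT = {T. T \<subseteq> J \<and> card T < card I}"
  define E where "E T = {x. \<forall>j\<in>J - T. r (x j) \<in> vs.span (r ` x ` T)}" for T
  have "finite TT" using fin by (auto simp: TT_def)
  have "?E \<subseteq> (\<Union>T\<in>TT. E T)"
  proof
    fix x assume x: "x \<in> ?E"
    obtain B where B: "B \<subseteq> (\<lambda>j. r (x j)) ` J" "vs.independent B" "(\<lambda>j. r (x j)) ` J \<subseteq> vs.span B"
      "card B = vs.dim ((\<lambda>j. r (x j)) ` J)" by (rule vs.basis_exists)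
    from B(1) obtain T where T: "T \<subseteq> J" "inj_on (\<lambda>j. r (x j)) T" "B = (\<lambda>j. r (x j)) ` T"
      by (meson subset_image_inj)
    have "card T = card B" using T by (simp add: card_image)
    hence "T \<in> TT" using x T B by (auto simp: TT_def r_def)
    moreover have "x \<in> E T" using B T by (auto simp: E_def image_image)
    ultimately show "x \<in> (\<Union>T\<in>TT. E T)" by blast
  qed
  hence "measure_pmf.prob ?M ?E \<le> measure_pmf.prob ?M (\<Union>T\<in>TT. E T)"
    by (intro measure_pmf.finite_measure_mono) auto
  also have "\<dots> \<le> (\<Sum>T\<in>TT. measure_pmf.prob ?M (E T))"
    using \<open>finite TT\<close> by (intro measure_pmf.finite_measure_subadditive_finite) auto
  also have "\<dots> \<le> (\<Sum>T\<in>TT. \<rho> ^ (card J - card I))"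
  proof (rule sum_mono)
    fix T assume T: "T \<in> TT"
    define D where "D = J - T"
    have TD: "finite T" "finite D" "T \<inter> D = {}" "T \<union> D = J"
      using T fin finite_subset by (auto simp: TT_def D_def)
    let ?g = "\<lambda>(f :: 'a \<Rightarrow> nat \<Rightarrow> int) g x. if x \<in> T then f x else g x"
    have "measure_pmf.prob ?M (E T) =
      measure_pmf.prob (pair_pmf (Pi_pmf T d (\<lambda>_. ?col)) (Pi_pmf D d (\<lambda>_. ?col)))
        {(f, g). True \<and> (\<forall>j\<in>D. r (g j) \<in> vs.span (r ` f ` T))}"
    proof -
      have "(?g f g \<in> E T) = (\<forall>j\<in>D. r (g j) \<in> vs.span (r ` f ` T))" for f g
      proof -
        have "?g f g ` T = f ` T" by auto
        thus ?thesis by (auto simp: E_def D_def)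
      qed
      thus ?thesis by (subst prob_Pi_pmf_split[OF TD]) simp
    qed
    also have "\<dots> \<le> measure_pmf.prob (Pi_pmf T d (\<lambda>_. ?col)) {f. True} * \<rho> ^ card D"
    proof (rule prob_pair_pmf_le)
      show "finite (set_pmf (Pi_pmf T d (\<lambda>_. ?col)))"
        using TD fin by (intro finite_set_Pi_pmf)
      fix f :: "'a \<Rightarrow> nat \<Rightarrow> int"
      have "{g. \<forall>j\<in>D. r (g j) \<in> vs.span (r ` f ` T)} = Pi D (\<lambda>_. {y. r y \<in> vs.span (r ` f ` T)})"
        by auto
      hence "measure_pmf.prob (Pi_pmf D d (\<lambda>_. ?col)) {g. \<forall>j\<in>D. r (g j) \<in> vs.span (r ` f ` T)} =
        (\<Prod>j\<in>D. measure_pmf.prob ?col {y. r y \<in> vs.span (r ` f ` T)})"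
        using TD by (simp only: measure_Pi_pmf_Pi)
      also have "\<dots> \<le> (\<Prod>j\<in>D. \<rho>)"
      proof (intro prod_mono conjI)
        have "measure_pmf.prob ?col {y. r y \<in> vs.span (r ` f ` T)} \<le> \<rho> ^ (card I - card (r ` f ` T))"
          unfolding r_def using fin TD rho by (intro prob_restr_in_span_le) auto
        also have "card (r ` f ` T) \<le> card T"
          using TD by (simp add: card_image_le image_image)
        hence "\<rho> ^ (card I - card (r ` f ` T)) \<le> \<rho> ^ 1"
          using T rho rho0 by (intro power_decreasing) (auto simp: TT_def)
        finally show "measure_pmf.prob ?col {y. r y \<in> vs.span (r ` f ` T)} \<le> \<rho>" by simp
      qed auto
      finally show "measure_pmf.prob (Pi_pmf D d (\<lambda>_. ?col)) {g. \<forall>j\<in>D. r (g j) \<in> vs.span (r ` f ` T)} \<le> \<rho> ^ card D"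
        by simp
    qed
    also have "\<dots> \<le> \<rho> ^ (card J - card I)"
    proof -
      have "card J - card I \<le> card D"
        using T card_Un_disjoint[OF TD(1-3)] TD(4) by (auto simp: TT_def)
      thus ?thesis using rho rho0 by (simp add: power_decreasing)
    qed
    finally show "measure_pmf.prob ?M (E T) \<le> \<rho> ^ (card J - card I)" .
  qed
  also have "\<dots> = card TT * \<rho> ^ (card J - card I)" by simp
  also have "\<dots> \<le> 2 ^ card J * \<rho> ^ (card J - card I)"
  proof (rule mult_right_mono)
    have "card TT \<le> card (Pow J)" using fin by (intro card_mono) (auto simp: TT_def)
    thus "real (card TT) \<le> 2 ^ card J" using fin
      by (metis card_Pow of_nat_le_iff of_nat_numeral of_nat_power)
  qed (use rho0 in auto)
  finally show ?thesis .
qed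

section \<open>Lazy walks and their characteristic functions\<close>

lemma prod_sum_Pi_dflt:
  fixes f :: "'a \<Rightarrow> 'b \<Rightarrow> 'c :: comm_semiring_1"
  assumes "finite A" "\<And>x. x \<in> A \<Longrightarrow> finite (B x)"
  shows "(\<Sum>h\<in>PiE_dflt A d B. \<Prod>x\<in>A. f x (h x)) = (\<Prod>x\<in>A. \<Sum>y\<in>B x. f x y)"
proof -
  have "(\<Prod>x\<in>A. \<Sum>y\<in>B x. f x y) = (\<Sum>h\<in>PiE A B. \<Prod>x\<in>A. f x (h x))"
    using assms by (intro prod_sum_PiE) auto
  also have "\<dots> = (\<Sum>h\<in>(\<lambda>h. restrict h A) ` PiE_dflt A d B. \<Prod>x\<in>A. f x (h x))"
    by (simp add: restrict_PiE_dflt)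
  also have "\<dots> = (\<Sum>h\<in>PiE_dflt A d B. \<Prod>x\<in>A. f x (restrict h A x))"
  proof (subst sum.reindex)
    show "inj_on (\<lambda>h. restrict h A) (PiE_dflt A d B)"
      by (auto simp: inj_on_def PiE_dflt_def fun_eq_iff restrict_def) metis
  qed auto
  also have "\<dots> = (\<Sum>h\<in>PiE_dflt A d B. \<Prod>x\<in>A. f x (h x))"
    by (intro sum.cong prod.cong) auto
  finally show ?thesis by simp
qed

definition cf :: "int pmf \<Rightarrow> real \<Rightarrow> complex" where
  "cf p \<theta> = (\<Sum>z\<in>set_pmf p. of_real (pmf p z) * cis (\<theta> * of_int z))"

lemma cf_map_pmf:
  assumes "finite (set_pmf M)"
  shows "cf (map_pmf f M) \<theta> = (\<Sum>x\<in>set_pmf M. of_real (pmf M x) * cis (\<theta> * of_int (f x)))"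
proof -
  have "cf (map_pmf f M) \<theta> =
    (\<Sum>z\<in>f ` set_pmf M. \<Sum>x\<in>{x\<in>set_pmf M. f x = z}. of_real (pmf M x) * cis (\<theta> * of_int (f x)))"
    unfolding cf_def set_map_pmf
  proof (intro sum.cong refl)
    fix z
    have "pmf (map_pmf f M) z = measure_pmf.prob M {x\<in>set_pmf M. f x = z}"
      unfolding pmf_map by (intro measure_pmf.finite_measure_eq_AE) (auto simp: AE_measure_pmf_iff)
    also have "\<dots> = (\<Sum>x\<in>{x\<in>set_pmf M. f x = z}. pmf M x)"
      using assms by (intro measure_measure_pmf_finite) auto
    finally show "of_real (pmf (map_pmf f M) z) * cis (\<theta> * of_int z) =
        (\<Sum>x\<in>{x\<in>set_pmf M. f x = z}. of_real (pmf M x) * cis (\<theta> * of_int (f x)))"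
      by (auto simp: sum_distrib_right intro!: sum.cong)
  qed
  also have "\<dots> = (\<Sum>x\<in>set_pmf M. of_real (pmf M x) * cis (\<theta> * of_int (f x)))"
    using assms by (rule sum.image_gen[symmetric])
  finally show ?thesis .
qed

lemma cf_linear_form:
  assumes "finite K" "finite (set_pmf p)"
  shows "cf (map_pmf (\<lambda>x. \<Sum>i\<in>K. a i * x i) (Pi_pmf K 0 (\<lambda>_. p))) \<theta> = (\<Prod>i\<in>K. cf p (\<theta> * of_int (a i)))"
proof -
  have cis_sum: "cis (\<Sum>i\<in>K. g i) = (\<Prod>i\<in>K. cis (g i))" for g
    using assms(1) by (induction K rule: finite_induct) (auto simp: cis_mult[symmetric])
  have "cf (map_pmf (\<lambda>x. \<Sum>i\<in>K. a i * x i) (Pi_pmf K 0 (\<lambda>_. p))) \<theta> =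
    (\<Sum>x\<in>PiE_dflt K 0 (\<lambda>_. set_pmf p). \<Prod>i\<in>K. of_real (pmf p (x i)) * cis (\<theta> * of_int (a i) * of_int (x i)))"
    using finite_set_Pi_pmf[OF assms, of 0] assms(1)
    by (subst cf_map_pmf)
      (auto simp: set_Pi_pmf comp_def pmf_Pi PiE_dflt_def prod.distrib
        sum_distrib_left mult.assoc simp flip: cis_sum intro!: sum.cong)
  also have "\<dots> = (\<Prod>i\<in>K. \<Sum>z\<in>set_pmf p. of_real (pmf p z) * cis (\<theta> * of_int (a i) * of_int z))"
    using assms by (intro prod_sum_Pi_dflt) auto
  finally show ?thesis by (simp add: cf_def)
qed

lemma sum_cis_eq:
  assumes "N > 0" "\<not> int N dvd z"
  shows "(\<Sum>\<xi><N. cis (2 * pi * real \<xi> / real N * of_int z)) = 0"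
proof -
  define w where "w = cis (2 * pi * of_int z / real N)"
  have "w ^ N = cis (real N * (2 * pi * of_int z / real N))"
    unfolding w_def by (rule Complex.DeMoivre)
  also have "real N * (2 * pi * of_int z / real N) = 2 * pi * of_int z"
    using assms by simp
  also have "cis \<dots> = 1"
    by (simp add: cis_multiple_2pi)
  finally have wN: "w ^ N = 1" .
  have "w \<noteq> 1"
  proof
    assume "w = 1"
    hence "cos (2 * pi * of_int z / real N) = 1"
      by (simp add: w_def complex_eq_iff)
    then obtain n :: int where "2 * pi * of_int z / real N = of_int n * 2 * pi"
      by (auto simp: cos_one_2pi_int)
    hence "real_of_int z = of_int n * real N"
      using assms by (simp add: field_simps)
    hence "z = n * int N"
      by (metis of_int_eq_iff of_int_mult of_int_of_nat_eq)
    with assms show False by simp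
  qed
  have "(\<Sum>\<xi><N. cis (2 * pi * real \<xi> / real N * of_int z)) = (\<Sum>\<xi><N. w ^ \<xi>)"
    unfolding w_def Complex.DeMoivre by (intro sum.cong refl arg_cong[of _ _ cis]) (simp add: field_simps)
  also have "\<dots> = 0"
    using \<open>w \<noteq> 1\<close> wN by (simp add: sum_gp_strict)
  finally show ?thesis .
qed

text \<open>Fourier inversion on Z/N: support inside (-N, N) leaves 0 as the only multiple of N, so
  nothing is lost modulo N. A finite group of frequencies, instead of the circle, allows frequencies
  to be counted later.\<close>

lemma pmf_0_fourier:
  assumes "finite (set_pmf q)" "\<And>z. z \<in> set_pmf q \<Longrightarrow> \<bar>z\<bar> < int N" "N > 0"
  shows "complex_of_real (pmf q 0) = (\<Sum>\<xi><N. cf q (2 * pi * real \<xi> / real N)) / of_nat N"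
proof -
  have "(\<Sum>\<xi><N. cf q (2 * pi * real \<xi> / real N)) =
    (\<Sum>z\<in>set_pmf q. \<Sum>\<xi><N. of_real (pmf q z) * cis (2 * pi * real \<xi> / real N * of_int z))"
    unfolding cf_def by (rule sum.swap)
  also have "\<dots> = (\<Sum>z\<in>set_pmf q. if z = 0 then of_real (pmf q 0) * of_nat N else 0)"
  proof (intro sum.cong refl)
    fix z assume z: "z \<in> set_pmf q"
    show "(\<Sum>\<xi><N. of_real (pmf q z) * cis (2 * pi * real \<xi> / real N * of_int z)) =
      (if z = 0 then of_real (pmf q 0) * of_nat N else 0)"
    proof (cases "z = 0")
      case False
      hence "\<not> int N dvd z"
        using assms(2)[OF z] zdvd_not_zless[of "\<bar>z\<bar>" "int N"] by auto
      thus ?thesis using False sum_cis_eq[OF assms(3), of z] by (simp flip: sum_distrib_left)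
    qed auto
  qed
  also have "\<dots> = of_real (pmf q 0) * of_nat N"
    using assms(1) by (auto simp: set_pmf_eq)
  finally show ?thesis using assms(3) by simp
qed

section \<open>Lazy walks\<close>

definition lazy_step :: "nat \<Rightarrow> int pmf" where
  "lazy_step L = map_pmf (\<lambda>j::nat. if j = 0 then 1 else if j = 1 then -1 else 0) (pmf_of_set {..<L})"

text \<open>The factor $1$ makes the sum an instance of the linear forms in \<open>cf_linear_form\<close>.\<close>

definition walk :: "nat \<Rightarrow> nat \<Rightarrow> int pmf" where
  "walk L n = map_pmf (\<lambda>x. \<Sum>i\<in>{..<n}. 1 * x i) (Pi_pmf {..<n} 0 (\<lambda>_. lazy_step L))"

lemma set_lazy_step: "L \<ge> 2 \<Longrightarrow> set_pmf (lazy_step L) \<subseteq> {-1..1}"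
  by (subst lazy_step_def) (auto simp: set_pmf_of_set)

lemma finite_set_lazy_step: "L \<ge> 2 \<Longrightarrow> finite (set_pmf (lazy_step L))"
  using set_lazy_step finite_subset by blast

lemma set_walk:
  assumes "L \<ge> 2"
  shows "set_pmf (walk L n) \<subseteq> {- int n..int n}"
proof -
  have "\<bar>\<Sum>i<n. x i\<bar> \<le> int n" if "x \<in> set_pmf (Pi_pmf {..<n} 0 (\<lambda>_. lazy_step L))" for x
  proof -
    have "\<bar>x i\<bar> \<le> 1" if "i < n" for i
      using that \<open>x \<in> _\<close> set_lazy_step[OF assms] by (fastforce simp: set_Pi_pmf PiE_dflt_def)
    hence "(\<Sum>i<n. \<bar>x i\<bar>) \<le> (\<Sum>i<n. 1)" by (intro sum_mono) auto
    thus ?thesis using order_trans[OF sum_abs[of x "{..<n}"]] by simp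
  qed
  thus ?thesis by (fastforce simp: walk_def abs_le_iff)
qed

lemma finite_set_walk: "L \<ge> 2 \<Longrightarrow> finite (set_pmf (walk L n))"
  using set_walk finite_subset by blast

text \<open>The purpose of laziness: this value is nonnegative as soon as \<open>L \<ge> 4\<close>,
  so Fourier sums have no cancellation and can be compared term by term. The plain walk,
  \<open>L = 2\<close>, has the sign-changing cosine.\<close>

lemma cf_lazy_step:
  assumes "L \<ge> 2"
  shows "cf (lazy_step L) \<theta> = of_real (1 - 4 / real L * (sin (\<theta> / 2))\<^sup>2)"
proof -
  obtain l where l: "L = Suc (Suc l)" using assms by (metis add_2_eq_Suc le_Suc_ex)
  have "cf (lazy_step L) \<theta> = (\<Sum>j<L. of_real (1 / real L) *
      cis (\<theta> * of_int (if j = 0 then 1 else if j = 1 then -1 else 0)))"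
    unfolding lazy_step_def using assms
    by (subst cf_map_pmf) (auto simp: set_pmf_of_set lessThan_empty_iff intro!: sum.cong)
  also have "\<dots> = of_real (1 / real L) * (cis \<theta> + cis (- \<theta>) + of_nat l)"
    unfolding l by (simp add: sum.lessThan_Suc_shift algebra_simps add_divide_distrib del: sum.lessThan_Suc)
  also have "cis \<theta> + cis (- \<theta>) = of_real (2 * cos \<theta>)"
    by (simp add: complex_eq_iff)
  also have "cos \<theta> = 1 - 2 * (sin (\<theta> / 2))\<^sup>2"
    using cos_double_sin[of "\<theta> / 2"] by simp
  also have "of_real (1 / real L) * (of_real (2 * (1 - 2 * (sin (\<theta> / 2))\<^sup>2)) + of_nat l) =
      complex_of_real (1 / real L * (2 * (1 - 2 * (sin (\<theta> / 2))\<^sup>2) + real l))"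
    by simp
  also have "1 / real L * (2 * (1 - 2 * (sin (\<theta> / 2))\<^sup>2) + real l) = 1 - 4 / real L * (sin (\<theta> / 2))\<^sup>2"
    unfolding l by (simp add: field_simps)
  finally show ?thesis .
qed

lemma cf_walk:
  assumes "L \<ge> 2"
  shows "cf (walk L n) \<theta> = of_real ((1 - 4 / real L * (sin (\<theta> / 2))\<^sup>2) ^ n)"
  unfolding walk_def using assms
  by (subst cf_linear_form) (auto simp: finite_set_lazy_step cf_lazy_step)

text \<open>Comparable to the squared distance of the vector \<open>\<xi> a / N\<close> from the integer lattice.\<close>

definition lattice_defect :: "nat \<Rightarrow> nat set \<Rightarrow> (nat \<Rightarrow> int) \<Rightarrow> int \<Rightarrow> real" where
  "lattice_defect N K a \<xi> = (\<Sum>i\<in>K. (sin (pi * of_int (a i) * of_int \<xi> / real N))\<^sup>2)"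

lemma lattice_defect_nonneg: "0 \<le> lattice_defect N K a \<xi>"
  by (auto simp: lattice_defect_def intro: sum_nonneg)

lemma pmf_linear_form:
  assumes "finite K" "L \<ge> 2" "N > 0" "(\<Sum>i\<in>K. \<bar>a i\<bar>) * int n < int N"
  shows "measure_pmf.prob (Pi_pmf K 0 (\<lambda>_. walk L n)) {x. (\<Sum>i\<in>K. a i * x i) = 0} =
    (\<Sum>\<xi><N. \<Prod>i\<in>K. (1 - 4 / real L * (sin (pi * of_int (a i) * of_int (int \<xi>) / real N))\<^sup>2) ^ n) / real N"
proof -
  let ?M = "Pi_pmf K 0 (\<lambda>_. walk L n)"
  let ?q = "map_pmf (\<lambda>x. \<Sum>i\<in>K. a i * x i) ?M"
  have fin: "finite (set_pmf ?M)"
    using assms by (intro finite_set_Pi_pmf finite_set_walk)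
  have "measure_pmf.prob ?M {x. (\<Sum>i\<in>K. a i * x i) = 0} = pmf ?q 0"
    by (simp add: pmf_map vimage_def)
  also have "complex_of_real (pmf ?q 0) = (\<Sum>\<xi><N. cf ?q (2 * pi * real \<xi> / real N)) / of_nat N"
  proof (rule pmf_0_fourier)
    fix z assume "z \<in> set_pmf ?q"
    then obtain x where x: "x \<in> set_pmf ?M" "z = (\<Sum>i\<in>K. a i * x i)" by auto
    have "\<bar>x i\<bar> \<le> int n" if "i \<in> K" for i
      using that x(1) set_walk[OF assms(2), of n] assms(1)
      by (fastforce simp: set_Pi_pmf PiE_dflt_def)
    hence "(\<Sum>i\<in>K. \<bar>a i * x i\<bar>) \<le> (\<Sum>i\<in>K. \<bar>a i\<bar> * int n)"
      by (intro sum_mono) (auto simp: abs_mult intro!: mult_left_mono)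
    also have "\<dots> < int N" using assms by (simp add: sum_distrib_right)
    finally show "\<bar>z\<bar> < int N" unfolding x(2) by (rule le_less_trans[OF sum_abs])
  qed (use fin assms in auto)
  also have "(\<Sum>\<xi><N. cf ?q (2 * pi * real \<xi> / real N)) = of_real
    (\<Sum>\<xi><N. \<Prod>i\<in>K. (1 - 4 / real L * (sin (pi * of_int (a i) * of_int (int \<xi>) / real N))\<^sup>2) ^ n)"
    unfolding cf_linear_form[OF assms(1) finite_set_walk[OF assms(2)]] cf_walk[OF assms(2)]
    by (simp add: mult_ac)
  finally have "complex_of_real (measure_pmf.prob ?M {x. (\<Sum>i\<in>K. a i * x i) = 0}) = complex_of_real
    ((\<Sum>\<xi><N. \<Prod>i\<in>K. (1 - 4 / real L * (sin (pi * of_int (a i) * of_int (int \<xi>) / real N))\<^sup>2) ^ n) / real N)"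
    by simp
  thus ?thesis by (simp only: of_real_eq_iff)
qed

lemma one_minus_power_le:
  fixes s c :: real
  assumes "0 \<le> s" "s \<le> 1" "0 \<le> c" "c \<le> 1"
  shows "(1 - c * s) ^ n \<le> exp (- (c * real n) * s)"
proof -
  have "c * s \<le> 1 * 1" using assms by (intro mult_mono) auto
  moreover have "1 - c * s \<le> exp (- (c * s))" using exp_ge_add_one_self[of "- (c * s)"] by simp
  ultimately have "(1 - c * s) ^ n \<le> exp (- (c * s)) ^ n" by (intro power_mono) auto
  thus ?thesis by (simp add: exp_of_nat_mult[symmetric] algebra_simps)
qed

lemma one_minus_half_power_ge:
  fixes s :: real
  assumes "0 \<le> s" "s \<le> 1"
  shows "exp (- real n * s) \<le> (1 - s / 2) ^ n"
proof -
  have "exp (- s) = 1 / exp s" by (simp add: exp_minus field_simps)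
  also have "\<dots> \<le> 1 / (1 + s)" using assms exp_ge_add_one_self[of s] by (intro divide_left_mono) auto
  also have "\<dots> \<le> 1 - s / 2"
  proof -
    have "s * s \<le> s * 1" using assms by (intro mult_left_mono) auto
    thus ?thesis using assms by (simp add: field_simps)
  qed
  finally have "exp (- s) ^ n \<le> (1 - s / 2) ^ n" by (intro power_mono) auto
  thus ?thesis by (simp add: exp_of_nat_mult[symmetric] algebra_simps)
qed

text \<open>For L = 4 a step contributes 1 - sin^2 \<le> exp(-sin^2); for L = 8, in the next lemma,
  it contributes 1 - sin^2 / 2 \<ge> exp(-sin^2). So the same exponential sum bounds one walk from
  above and the other, of equal length, from below.\<close>

lemma prob_orth_walk4_le:
  assumes "finite K" "N > 0" "(\<Sum>i\<in>K. \<bar>a i\<bar>) * int n < int N"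
  shows "measure_pmf.prob (Pi_pmf K 0 (\<lambda>_. walk 4 n)) {x. (\<Sum>i\<in>K. a i * x i) = 0} \<le>
    (\<Sum>\<xi><N. exp (- real n * lattice_defect N K a (int \<xi>))) / real N"
proof -
  have "(\<Prod>i\<in>K. (1 - (sin (pi * of_int (a i) * of_int \<xi> / real N))\<^sup>2) ^ n) \<le> exp (- real n * lattice_defect N K a \<xi>)" for \<xi>
  proof -
    have "exp (- real n * lattice_defect N K a \<xi>) = (\<Prod>i\<in>K. exp (- real n * (sin (pi * of_int (a i) * of_int \<xi> / real N))\<^sup>2))"
      by (simp add: lattice_defect_def sum_distrib_left exp_sum assms(1) sum_negf[symmetric])
    moreover have "(1 - x\<^sup>2) ^ n \<le> exp (- real n * x\<^sup>2) \<and> 0 \<le> (1 - x\<^sup>2) ^ n" if "x\<^sup>2 \<le> 1" for x :: real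
      using one_minus_power_le[of "x\<^sup>2" 1 n] that by simp
    ultimately show ?thesis by (auto intro!: prod_mono simp: abs_square_le_1)
  qed
  from this[of "int _"] show ?thesis using assms
    by (subst pmf_linear_form) (auto intro!: divide_right_mono sum_mono)
qed

lemma prob_orth_walk8_ge:
  assumes "finite K" "N > 0" "(\<Sum>i\<in>K. \<bar>a i\<bar>) * int n < int N"
  shows "measure_pmf.prob (Pi_pmf K 0 (\<lambda>_. walk 8 n)) {x. (\<Sum>i\<in>K. a i * x i) = 0} \<ge>
    (\<Sum>\<xi><N. exp (- real n * lattice_defect N K a (int \<xi>))) / real N"
proof -
  have "(\<Prod>i\<in>K. (1 - 4 / 8 * (sin (pi * of_int (a i) * of_int \<xi> / real N))\<^sup>2) ^ n) \<ge> exp (- real n * lattice_defect N K a \<xi>)" for \<xi>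
  proof -
    have "exp (- real n * lattice_defect N K a \<xi>) = (\<Prod>i\<in>K. exp (- real n * (sin (pi * of_int (a i) * of_int \<xi> / real N))\<^sup>2))"
      by (simp add: lattice_defect_def sum_distrib_left exp_sum assms(1) sum_negf[symmetric])
    moreover have "(1 - 4 / 8 * x\<^sup>2) ^ n \<ge> exp (- real n * x\<^sup>2)" if "x\<^sup>2 \<le> 1" for x :: real
      using one_minus_half_power_ge[of "x\<^sup>2" n] that by simp
    ultimately show ?thesis by (auto intro!: prod_mono simp: abs_square_le_1)
  qed
  from this[of "int _"] show ?thesis using assms
    by (subst pmf_linear_form) (auto intro!: divide_right_mono sum_mono)
qed

text \<open>Shifting by z multiplies the characteristic function by a phase, so absolute values give
  one bound for all z. Writing it as the defect of the one-coordinate form with coefficient 1 makes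
  the growth estimate applicable. The modulus exceeds 2n because differences of two values of the
  walk occur.\<close>

lemma pmf_walk_le:
  assumes "L \<ge> 4" "N > 2 * n"
  shows "pmf (walk L n) z \<le> (\<Sum>\<xi><N. exp (- (4 / real L * real n) * lattice_defect N {0} (\<lambda>_. 1) (int \<xi>))) / real N"
proof (cases "z \<in> set_pmf (walk L n)")
  case False
  hence "pmf (walk L n) z = 0" by (simp add: set_pmf_eq)
  thus ?thesis by (auto intro!: divide_nonneg_nonneg sum_nonneg)
next
  case True
  let ?q = "map_pmf (\<lambda>x. x - z) (walk L n)"
  have L: "L \<ge> 2" using assms by simp
  have "complex_of_real (pmf ?q 0) = (\<Sum>\<xi><N. cf ?q (2 * pi * real \<xi> / real N)) / of_nat N"
  proof (rule pmf_0_fourier)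
    fix y assume "y \<in> set_pmf ?q"
    then obtain x where x: "x \<in> set_pmf (walk L n)" "y = x - z" by auto
    with True set_walk[OF L, of n] have "\<bar>x\<bar> \<le> int n" "\<bar>z\<bar> \<le> int n" by force+
    with x assms show "\<bar>y\<bar> < int N" by simp
  qed (use finite_set_walk[OF L] assms in auto)
  moreover have "pmf ?q 0 = pmf (walk L n) z"
    by (simp add: pmf_map vimage_def measure_pmf_single)
  ultimately have "complex_of_real (pmf (walk L n) z) = (\<Sum>\<xi><N. cf ?q (2 * pi * real \<xi> / real N)) / of_nat N"
    by simp
  hence "pmf (walk L n) z = norm ((\<Sum>\<xi><N. cf ?q (2 * pi * real \<xi> / real N)) / of_nat N)"
    by (metis abs_of_nonneg norm_of_real pmf_nonneg)
  also have "\<dots> \<le> (\<Sum>\<xi><N. norm (cf ?q (2 * pi * real \<xi> / real N))) / real N"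
    by (auto simp: norm_divide intro!: divide_right_mono sum_norm_le)
  also have "\<dots> \<le> (\<Sum>\<xi><N. exp (- (4 / real L * real n) * lattice_defect N {0} (\<lambda>_. 1) (int \<xi>))) / real N"
  proof (intro divide_right_mono sum_mono)
    fix \<xi>
    define \<theta> where "\<theta> = 2 * pi * real \<xi> / real N"
    have "cf ?q \<theta> = cis (- \<theta> * of_int z) * cf (walk L n) \<theta>"
      using finite_set_walk[OF L]
      by (subst cf_map_pmf) (auto simp: cf_def sum_distrib_left cis_mult algebra_simps intro!: sum.cong)
    hence "norm (cf ?q \<theta>) = \<bar>(1 - 4 / real L * (sin (\<theta> / 2))\<^sup>2) ^ n\<bar>"
      by (simp add: norm_mult cf_walk[OF L] del: of_real_power of_real_diff)
    also have "\<dots> \<le> exp (- (4 / real L * real n) * (sin (\<theta> / 2))\<^sup>2)"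
    proof -
      have "4 / real L * (sin (\<theta> / 2))\<^sup>2 \<le> 1 * 1"
        using assms by (intro mult_mono) (auto simp: abs_square_le_1)
      thus ?thesis using one_minus_power_le[of "(sin (\<theta> / 2))\<^sup>2" "4 / real L" n] assms
        by (auto simp: abs_square_le_1 power_abs)
    qed
    also have "(sin (\<theta> / 2))\<^sup>2 = lattice_defect N {0} (\<lambda>_. 1) (int \<xi>)"
      by (simp add: lattice_defect_def \<theta>_def)
    finally show "norm (cf ?q (2 * pi * real \<xi> / real N)) \<le> exp (- (4 / real L * real n) * lattice_defect N {0} (\<lambda>_. 1) (int \<xi>))"
      by (simp add: \<theta>_def)
  qed auto
  finally show ?thesis .
qed

section \<open>Comparison of hyperplane probabilities\<close>

lemma card_translate_periodic:
  fixes P :: "int \<Rightarrow> bool"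
  assumes "N > 0" and per: "\<And>x. P (x mod N) \<longleftrightarrow> P x"
  shows "card {y\<in>{0..<N}. P (y - x)} = card {y\<in>{0..<N}. P y}"
proof -
  have "bij_betw (\<lambda>y. (y - x) mod N) {y\<in>{0..<N}. P (y - x)} {y\<in>{0..<N}. P y}"
    by (rule bij_betw_byWitness[of _ "\<lambda>z. (z + x) mod N"])
      (use assms(1) in \<open>auto simp: per mod_simps\<close>, (subst per[symmetric], simp add: mod_simps per)+)
  thus ?thesis by (rule bij_betw_same_card)
qed

text \<open>Translates of \<open>{\<Lambda> \<le> t}\<close> by points where \<open>\<Lambda>\<close> is about \<open>3 i t\<close> are disjoint; such points
  exist because \<open>\<Lambda>\<close> grows by at most \<open>t\<close> from one integer to the next.\<close>

lemma card_sublevel_growth: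
  fixes \<Lambda> :: "int \<Rightarrow> real"
  assumes N: "N > 0" and per: "\<And>x. \<Lambda> (x mod N) = \<Lambda> x"
    and tri: "\<And>x y. \<Lambda> (x + y) \<le> \<Lambda> x + \<Lambda> y" and sym: "\<And>x. \<Lambda> (- x) = \<Lambda> x"
    and zero: "\<Lambda> 0 = 0" and nonneg: "\<And>x. 0 \<le> \<Lambda> x"
    and one: "\<Lambda> 1 \<le> t" and big: "\<Lambda> \<xi> > real (3 * j + 2) * t"
  shows "(j + 1) * card {x\<in>{0..<N}. \<Lambda> x \<le> t} \<le> card {x\<in>{0..<N}. \<Lambda> x \<le> real (3 * j + 2) * t}"
proof -
  have lin: "\<Lambda> (int n) \<le> real n * \<Lambda> 1" for n
  proof (induction n)
    case (Suc n)
    thus ?case using tri[of "int n" 1] by (simp add: algebra_simps)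
  qed (simp add: zero)
  have big': "\<Lambda> (int (nat (\<xi> mod N))) > real (3 * j + 2) * t"
    using big N by (simp add: per)
  have "\<Lambda> 1 \<noteq> 0"
  proof
    assume "\<Lambda> 1 = 0"
    hence "real (3 * j + 2) * t < 0" using lin[of "nat (\<xi> mod N)"] big' by simp
    moreover have "0 \<le> t" using one \<open>\<Lambda> 1 = 0\<close> by simp
    ultimately show False by (simp add: mult_less_0_iff)
  qed
  hence l: "t > 0" using one nonneg[of 1] by linarith
  have "\<exists>x. real (3 * i) * t \<le> \<Lambda> x \<and> \<Lambda> x < real (3 * i + 1) * t" if "i \<le> j" for i
  proof (cases "i = 0")
    case True
    thus ?thesis using zero l by (intro exI[of _ 0]) auto
  next
    case False
    define Q where "Q n \<longleftrightarrow> real (3 * i) * t \<le> \<Lambda> (int n)" for n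
    have "real (3 * i) * t \<le> real (3 * j + 2) * t"
      using that l by (intro mult_right_mono) auto
    hence "Q (nat (\<xi> mod N))" using big' by (simp add: Q_def)
    define n where "n = (LEAST n. Q n)"
    have Qn: "Q n" unfolding n_def by (rule LeastI) fact
    have "\<not> Q 0" using False l by (simp add: Q_def zero not_le)
    hence "n \<noteq> 0" using Qn by (intro notI) simp
    then obtain n' where n': "n = Suc n'" by (cases n) auto
    have "\<not> Q n'" using not_less_Least[of n' Q] n' by (simp add: n_def)
    hence "\<Lambda> (int n) < real (3 * i + 1) * t"
      using tri[of "int n'" 1] one n' by (simp add: Q_def algebra_simps)
    thus ?thesis using Qn unfolding Q_def by blast
  qed
  then obtain x where x: "\<And>i. i \<le> j \<Longrightarrow> real (3 * i) * t \<le> \<Lambda> (x i)"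
    "\<And>i. i \<le> j \<Longrightarrow> \<Lambda> (x i) < real (3 * i + 1) * t" by metis
  define T where "T i = {y\<in>{0..<N}. \<Lambda> (y - x i) \<le> t}" for i
  \<comment> \<open>The triangle inequality, used both ways, confines \<Lambda> on
    \<open>T i\<close> to the band from (3i - 1)t to (3i + 2)t. Spacing 3 makes the bands disjoint,
    and the top of the last one, (3j + 2)t, is the origin of \<open>r = 3 * j + 2\<close> in later
    lemmas.\<close>
  have T: "real (3 * i) * t - t \<le> \<Lambda> y" "\<Lambda> y < real (3 * i + 2) * t" if "i \<le> j" "y \<in> T i" for i y
    using x[OF that(1)] tri[of "y - x i" "x i"] tri[of "- (y - x i)" y] that(2) sym[of "y - x i"]
    by (auto simp: T_def algebra_simps)
  have disj: "T i \<inter> T i' = {}" if "i < i'" "i' \<le> j" for i i'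
  proof (rule ccontr)
    assume "\<not> ?thesis"
    then obtain y where y: "y \<in> T i" "y \<in> T i'" by auto
    have "real (3 * i' - 1) * t \<ge> real (3 * i + 2) * t"
      using that l by (intro mult_right_mono) auto
    moreover have "real (3 * i' - 1) = real (3 * i') - 1" using that by (simp add: of_nat_diff)
    ultimately show False using T(2)[of i y] T(1)[of i' y] y that
      by (simp add: algebra_simps)
  qed
  have "(j + 1) * card {x\<in>{0..<N}. \<Lambda> x \<le> t} = (\<Sum>i\<le>j. card (T i))"
    unfolding T_def using card_translate_periodic[OF N, of "\<lambda>x. \<Lambda> x \<le> t"] by (simp add: per)
  also have "\<dots> = card (\<Union>i\<le>j. T i)"
  proof (subst card_UN_disjoint)
    show "\<forall>i\<in>{..j}. \<forall>i'\<in>{..j}. i \<noteq> i' \<longrightarrow> T i \<inter> T i' = {}"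
      using disj by (metis Int_commute atMost_iff linorder_neqE_nat)
  next
    have "T i \<subseteq> {0..<N}" for i by (auto simp: T_def)
    thus "\<forall>i\<in>{..j}. finite (T i)" using finite_subset[of _ "{0..<N}"] by blast
  qed auto
  also have "\<dots> \<le> card {x\<in>{0..<N}. \<Lambda> x \<le> real (3 * j + 2) * t}"
  proof (intro card_mono subsetI)
    fix y assume "y \<in> (\<Union>i\<le>j. T i)"
    then obtain i where i: "i \<le> j" "y \<in> T i" by auto
    have "real (3 * i + 2) * t \<le> real (3 * j + 2) * t"
      using i l by (intro mult_right_mono) auto
    with T(2)[OF i] i(2) show "y \<in> {x\<in>{0..<N}. \<Lambda> x \<le> real (3 * j + 2) * t}"
      by (auto simp: T_def)
  qed (rule finite_subset[of _ "{0..<N}"], auto)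
  finally show ?thesis .
qed

section \<open>From counting frequencies to exponential sums\<close>

lemma has_integral_superlevel:
  fixes h \<tau> b :: real
  assumes "\<tau> \<le> b"
  shows "((\<lambda>u. if u \<le> h then 1 else 0 :: real) has_integral max 0 (min h b - \<tau>)) {\<tau>..b}"
proof -
  have "((\<lambda>u. 1 :: real) has_integral max 0 (min h b - \<tau>)) {\<tau>..min h b}"
    using has_integral_const_real[of "1::real" \<tau> "min h b"] by (auto simp: max_def)
  also have "?this \<longleftrightarrow> ((\<lambda>u. if u \<in> {\<tau>..min h b} then 1 else 0 :: real) has_integral max 0 (min h b - \<tau>)) {\<tau>..b}"
    by (subst has_integral_restrict) auto
  finally show ?thesis
    by (rule has_integral_eq[rotated]) auto
qed

text \<open>Layer cake: the inequality of cardinalities is integrated over the levels from \<tau> to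
  b, the only ones at which it will be known. Levels below \<tau> lose at most
  \<open>c * \<tau> * card \<Omega>\<close>, and H is cut at b.\<close>

lemma sum_le_of_card_superlevel:
  fixes H G :: "'a \<Rightarrow> real" and c \<tau> b :: real
  assumes "finite \<Omega>" "0 \<le> \<tau>" "\<tau> \<le> b" "0 \<le> c"
    and G: "\<And>x. x \<in> \<Omega> \<Longrightarrow> 0 \<le> G x"
    and card: "\<And>u. \<tau> \<le> u \<Longrightarrow> u \<le> b \<Longrightarrow> c * card {x\<in>\<Omega>. u \<le> H x} \<le> card {x\<in>\<Omega>. u \<le> G x}"
  shows "c * (\<Sum>x\<in>\<Omega>. min (H x) b) \<le> c * \<tau> * card \<Omega> + (\<Sum>x\<in>\<Omega>. G x)"
proof -
  have cnt: "(\<Sum>x\<in>\<Omega>. if u \<le> F x then 1 else 0 :: real) = card {x\<in>\<Omega>. u \<le> F x}" for F :: "'a \<Rightarrow> real" and u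
    using assms(1) by (simp add: sum.If_cases Int_def conj_commute)
  have "c * (\<Sum>x\<in>\<Omega>. max 0 (min (H x) b - \<tau>)) \<le> (\<Sum>x\<in>\<Omega>. max 0 (min (G x) b - \<tau>))"
  proof (rule has_integral_le)
    show "((\<lambda>u. c * (\<Sum>x\<in>\<Omega>. if u \<le> H x then 1 else 0 :: real)) has_integral
        c * (\<Sum>x\<in>\<Omega>. max 0 (min (H x) b - \<tau>))) {\<tau>..b}"
      using assms by (intro has_integral_mult_right has_integral_sum has_integral_superlevel)
    show "((\<lambda>u. \<Sum>x\<in>\<Omega>. if u \<le> G x then 1 else 0 :: real) has_integral
        (\<Sum>x\<in>\<Omega>. max 0 (min (G x) b - \<tau>))) {\<tau>..b}"
      using assms by (intro has_integral_sum has_integral_superlevel)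
  qed (use card in \<open>auto simp: cnt\<close>)
  also have "\<dots> \<le> (\<Sum>x\<in>\<Omega>. G x)"
    using G assms(2) by (intro sum_mono) (force simp: max_def)
  finally have 1: "c * (\<Sum>x\<in>\<Omega>. max 0 (min (H x) b - \<tau>)) \<le> (\<Sum>x\<in>\<Omega>. G x)" .
  have "c * (\<Sum>x\<in>\<Omega>. min (H x) b - \<tau>) \<le> c * (\<Sum>x\<in>\<Omega>. max 0 (min (H x) b - \<tau>))"
    using assms(4) by (intro mult_left_mono sum_mono) auto
  with 1 show ?thesis by (simp add: sum_subtractf algebra_simps)
qed

text \<open>With \<Lambda> the square root of the defect, the superlevel sets of the two
  exponentials at one level are \<open>\<Lambda> \<le> t\<close> and
  \<open>\<Lambda> \<le> r * t\<close>, so the second is at least j + 1 times as large. At levels u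
  \<ge> \<tau> the hypothesis \<open>small\<close> gives a frequency beyond \<open>r * t\<close>; at
  levels u \<le> 1/2 the hypothesis \<open>one\<close> gives
  \<open>\<Lambda> 1 \<le> t\<close>.\<close>

lemma sum_exp_lattice_defect_le:
  assumes "finite K" "N > 0" "\<mu> > 0" and tau: "0 < \<tau>" "\<tau> \<le> 1 / 2"
    and r: "r = 3 * j + 2"
    and small: "exp (- \<mu> * lattice_defect N K a \<xi>0) < \<tau>"
    and one: "exp (- (\<mu> * real r ^ 2) * lattice_defect N K a 1) \<ge> 1 / 2"
  shows "(\<Sum>\<xi><N. exp (- (\<mu> * real r ^ 2) * lattice_defect N K a (int \<xi>))) \<le>
    2 * \<tau> * real N + 2 / real (j + 1) * (\<Sum>\<xi><N. exp (- \<mu> * lattice_defect N K a (int \<xi>)))"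
proof -
  define \<Lambda> where "\<Lambda> x = L2_set (\<lambda>i. sin (pi * of_int (a i) * of_int x / real N)) K" for x
  have lattice_defect: "lattice_defect N K a x = \<Lambda> x ^ 2" for x
    by (simp add: lattice_defect_def \<Lambda>_def L2_set_def sum_nonneg)
  have nonneg: "0 \<le> \<Lambda> x" for x by (simp add: \<Lambda>_def)
  have zero: "\<Lambda> 0 = 0" by (simp add: \<Lambda>_def L2_set_def)
  have sym: "\<Lambda> (- x) = \<Lambda> x" for x by (simp add: \<Lambda>_def L2_set_def)
  \<comment> \<open>The absolute value of the sine is subadditive, and Minkowski's inequality
    carries this to \<Lambda>. The defect itself, being a square, is not subadditive.\<close>
  have tri: "\<Lambda> (x + y) \<le> \<Lambda> x + \<Lambda> y" for x y
  proof -
    have sin_tri: "\<bar>sin (u + v)\<bar> \<le> \<bar>sin u\<bar> + \<bar>sin v\<bar>" for u v :: real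
    proof -
      have "\<bar>sin (u + v)\<bar> \<le> \<bar>sin u\<bar> * \<bar>cos v\<bar> + \<bar>cos u\<bar> * \<bar>sin v\<bar>"
        unfolding sin_add abs_mult[symmetric] by (rule abs_triangle_ineq)
      also have "\<dots> \<le> \<bar>sin u\<bar> * 1 + 1 * \<bar>sin v\<bar>"
        by (intro add_mono mult_mono) auto
      finally show ?thesis by simp
    qed
    define f where "f x i = \<bar>sin (pi * of_int (a i) * of_int x / real N)\<bar>" for x i
    have L: "\<Lambda> x = L2_set (f x) K" for x by (simp add: \<Lambda>_def f_def L2_set_def)
    have "f (x + y) i \<le> f x i + f y i" for i
      using sin_tri[of "pi * of_int (a i) * of_int x / real N" "pi * of_int (a i) * of_int y / real N"]
      by (simp add: f_def distrib_left add_divide_distrib)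
    hence "L2_set (f (x + y)) K \<le> L2_set (\<lambda>i. f x i + f y i) K"
      by (intro L2_set_mono) (auto simp: f_def)
    also have "\<dots> \<le> L2_set (f x) K + L2_set (f y) K" by (rule L2_set_triangle_ineq)
    finally show ?thesis by (simp add: L)
  qed
  have per: "\<Lambda> (x mod int N) = \<Lambda> x" for x
  proof -
    have "\<Lambda> (int N * y) = 0" for y
    proof -
      have "sin (pi * of_int (a i) * of_int (int N * y) / real N) = sin (of_int (a i * y) * pi)" for i
        using assms(2) by (simp add: mult_ac)
      moreover have "sin (of_int (a i * y) * pi) = 0" for i by (subst sin_zero_iff_int2) blast
      ultimately show ?thesis by (simp add: \<Lambda>_def L2_set_def)
    qed
    note m = this[of "x div int N"]
    show ?thesis
      using tri[of "x mod int N" "int N * (x div int N)"] tri[of x "- (int N * (x div int N))"] m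
        sym[of "int N * (x div int N)"]
      by (simp add: minus_mult_div_eq_mod)
  qed
  have rpos: "real r > 0" using r by simp
  define \<Omega> where "\<Omega> = {0..<int N}"
  define H where "H x = exp (- (\<mu> * real r ^ 2) * \<Lambda> x ^ 2)" for x
  define G where "G x = exp (- \<mu> * \<Lambda> x ^ 2)" for x
  have "real (j + 1) * (\<Sum>x\<in>\<Omega>. min (H x) (1 / 2)) \<le> real (j + 1) * \<tau> * card \<Omega> + (\<Sum>x\<in>\<Omega>. G x)"
  proof (rule sum_le_of_card_superlevel)
    fix u :: real assume u: "\<tau> \<le> u" "u \<le> 1 / 2"
    have u0: "0 < u" using u tau by simp
    define t where "t = sqrt (ln (1 / u) / \<mu>) / real r"
    have lnu: "ln (1 / u) \<ge> 0" using u u0 by simp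
    have G_iff: "u \<le> G x \<longleftrightarrow> \<Lambda> x \<le> real r * t" for x
    proof -
      have "u \<le> G x \<longleftrightarrow> ln u \<le> - \<mu> * \<Lambda> x ^ 2" using u0 by (simp add: G_def ln_le_cancel_iff[symmetric] ln_ge_iff)
      also have "\<dots> \<longleftrightarrow> \<Lambda> x ^ 2 \<le> ln (1 / u) / \<mu>" using assms(3) u0 by (auto simp: field_simps ln_div)
      also have "\<dots> \<longleftrightarrow> \<Lambda> x \<le> sqrt (ln (1 / u) / \<mu>)"
        using nonneg[of x] by (metis abs_of_nonneg real_sqrt_abs real_sqrt_le_iff)
      finally show ?thesis using rpos by (simp add: t_def)
    qed
    have H_iff: "u \<le> H x \<longleftrightarrow> \<Lambda> x \<le> t" for x
    proof -
      have "u \<le> H x \<longleftrightarrow> ln u \<le> - (\<mu> * real r ^ 2) * \<Lambda> x ^ 2" using u0 by (simp add: H_def ln_le_cancel_iff[symmetric] ln_ge_iff)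
      also have "\<dots> \<longleftrightarrow> (real r * \<Lambda> x) ^ 2 \<le> ln (1 / u) / \<mu>"
        using assms(3) u0 by (auto simp: field_simps ln_div power_mult_distrib)
      also have "\<dots> \<longleftrightarrow> real r * \<Lambda> x \<le> sqrt (ln (1 / u) / \<mu>)"
        using nonneg[of x] rpos by (metis abs_of_nonneg mult_nonneg_nonneg less_imp_le real_sqrt_abs real_sqrt_le_iff)
      finally show ?thesis using rpos by (simp add: t_def field_simps)
    qed
    have "(j + 1) * card {x\<in>{0..<int N}. \<Lambda> x \<le> t} \<le> card {x\<in>{0..<int N}. \<Lambda> x \<le> real (3 * j + 2) * t}"
    proof (rule card_sublevel_growth)
      show "\<Lambda> 1 \<le> t" using one u by (simp add: H_iff[symmetric] H_def lattice_defect)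
      show "\<Lambda> \<xi>0 > real (3 * j + 2) * t"
        using small u G_iff[of \<xi>0] by (simp add: G_def lattice_defect r)
    qed (use assms(2) per tri sym zero nonneg in auto)
    hence "real ((j + 1) * card {x\<in>\<Omega>. u \<le> H x}) \<le> real (card {x\<in>\<Omega>. u \<le> G x})"
      unfolding G_iff H_iff \<Omega>_def r by (rule of_nat_mono)
    thus "real (j + 1) * real (card {x\<in>\<Omega>. u \<le> H x}) \<le> real (card {x\<in>\<Omega>. u \<le> G x})"
      by (simp only: of_nat_mult)
  qed (use tau in \<open>auto simp: \<Omega>_def G_def\<close>)
  hence *: "(\<Sum>x\<in>\<Omega>. min (H x) (1 / 2)) \<le> \<tau> * real N + 1 / real (j + 1) * (\<Sum>x\<in>\<Omega>. G x)"
    by (simp add: \<Omega>_def field_simps)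
  \<comment> \<open>As H is at most 1, undoing the cut at 1/2 costs a factor 2.\<close>
  have "(\<Sum>x\<in>\<Omega>. H x) \<le> (\<Sum>x\<in>\<Omega>. 2 * min (H x) (1 / 2))"
  proof (rule sum_mono)
    fix x
    have "H x \<le> 1" using assms(3) by (simp add: H_def)
    thus "H x \<le> 2 * min (H x) (1 / 2)" using exp_gt_zero by (auto simp: H_def min_def)
  qed
  also have "\<dots> = 2 * (\<Sum>x\<in>\<Omega>. min (H x) (1 / 2))" by (simp add: sum_distrib_left)
  also have "\<dots> \<le> 2 * (\<tau> * real N + 1 / real (j + 1) * (\<Sum>x\<in>\<Omega>. G x))" using * by simp
  finally have "(\<Sum>x\<in>\<Omega>. H x) \<le> 2 * \<tau> * real N + 2 / real (j + 1) * (\<Sum>x\<in>\<Omega>. G x)"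
    by (simp add: algebra_simps)
  moreover have "\<Omega> = int ` {..<N}"
    by (simp add: \<Omega>_def image_int_atLeastLessThan lessThan_atLeast0)
  hence "(\<Sum>x\<in>\<Omega>. F x) = (\<Sum>\<xi><N. F (int \<xi>))" for F :: "int \<Rightarrow> real"
    by (simp add: sum.reindex)
  ultimately show ?thesis by (simp add: H_def G_def lattice_defect)
qed

text \<open>For a nonzero \<open>a i\<close> below N in absolute value the mean of sin^2 over the N
  frequencies is 1/2, so the mean defect is half the size of the support, and some frequency reaches
  it. This is how many nonzero entries of a normal supply the distant frequency of the growth
  estimate.\<close>

lemma exists_large_lattice_defect:
  assumes "finite K" "N > 0" "\<And>i. i \<in> K \<Longrightarrow> \<bar>a i\<bar> < int N"
  shows "\<exists>\<xi>. lattice_defect N K a \<xi> \<ge> real (card {i\<in>K. a i \<noteq> 0}) / 2"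
proof (rule ccontr)
  assume "\<not> ?thesis"
  hence less: "lattice_defect N K a \<xi> < real (card {i\<in>K. a i \<noteq> 0}) / 2" for \<xi> by (meson not_le)
  have "(\<Sum>\<xi><N. lattice_defect N K a (int \<xi>)) = (\<Sum>i\<in>K. \<Sum>\<xi><N. (sin (pi * of_int (a i) * of_int (int \<xi>) / real N))\<^sup>2)"
    unfolding lattice_defect_def by (rule sum.swap)
  also have "\<dots> = (\<Sum>i\<in>K. if a i \<noteq> 0 then real N / 2 else 0)"
  proof (rule sum.cong)
    fix i assume i: "i \<in> K"
    show "(\<Sum>\<xi><N. (sin (pi * of_int (a i) * of_int (int \<xi>) / real N))\<^sup>2) = (if a i \<noteq> 0 then real N / 2 else 0)"
    proof (cases "a i = 0")
      case False
      have "\<not> int N dvd a i"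
        using False assms(3)[OF i] zdvd_not_zless[of "\<bar>a i\<bar>" "int N"] by auto
      hence "Re (\<Sum>\<xi><N. cis (2 * pi * real \<xi> / real N * of_int (a i))) = 0"
        by (subst sum_cis_eq[OF assms(2)]) auto
      hence c: "(\<Sum>\<xi><N. cos (2 * pi * real \<xi> / real N * of_int (a i))) = 0" by simp
      have "(sin (pi * of_int (a i) * of_int (int \<xi>) / real N))\<^sup>2 =
          1 / 2 - cos (2 * pi * real \<xi> / real N * of_int (a i)) / 2" for \<xi>
        using cos_double_sin[of "pi * of_int (a i) * of_int (int \<xi>) / real N"]
        by (simp add: mult_ac diff_divide_distrib)
      thus ?thesis using c False by (simp add: sum_subtractf flip: sum_divide_distrib)
    qed auto
  qed auto
  also have "\<dots> = real N * (real (card {i\<in>K. a i \<noteq> 0}) / 2)"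
    using assms(1) by (simp add: sum.If_cases Int_def)
  finally have "(\<Sum>\<xi><N. lattice_defect N K a (int \<xi>)) = real N * (real (card {i\<in>K. a i \<noteq> 0}) / 2)" .
  moreover have "(\<Sum>\<xi><N. lattice_defect N K a (int \<xi>)) < (\<Sum>\<xi><N. real (card {i\<in>K. a i \<noteq> 0}) / 2)"
    using less assms(2) by (intro sum_strict_mono) (auto simp: lessThan_empty_iff)
  ultimately show False by simp
qed

text \<open>The modulus is a free auxiliary parameter: as it grows, the defect at frequency 1 tends
  to 0, which provides the small step from one integer to the next.\<close>

lemma eventually_exp_lattice_defect:
  assumes "finite K"
  shows "eventually (\<lambda>N. exp (- c * lattice_defect N K a 1) \<ge> 1 / 2) sequentially"
proof -
  have "(\<lambda>N. exp (- c * lattice_defect N K a 1)) \<longlonglongrightarrow> exp (- c * (\<Sum>i\<in>K. (sin 0)\<^sup>2))"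
    unfolding lattice_defect_def
    by (intro tendsto_intros tendsto_divide_0[OF tendsto_const] filterlim_at_top_imp_at_infinity
        filterlim_real_sequentially)
  hence "(\<lambda>N. exp (- c * lattice_defect N K a 1)) \<longlonglongrightarrow> 1" by simp
  hence "eventually (\<lambda>N. exp (- c * lattice_defect N K a 1) > 1 / 2) sequentially"
    by (rule order_tendstoD) simp
  thus ?thesis by eventually_elim simp
qed

text \<open>The modulus N is gone: it is picked inside the proof, large enough for both inversions
  to be exact and for frequency 1 to be a small step. The factor r^2 between the lengths scales
  \<Lambda> by r, and \<open>2 * \<tau>\<close> is the loss from low levels.\<close>

lemma prob_orth_comparison:
  fixes a :: "nat \<Rightarrow> int"
  assumes "finite K" "m > 0" and tau: "0 < \<tau>" "\<tau> \<le> 1 / 2" and r: "r = 3 * j + 2"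
    and small: "exp (- real m * (real (card {i\<in>K. a i \<noteq> 0}) / 2)) < \<tau>"
  shows "measure_pmf.prob (Pi_pmf K 0 (\<lambda>_. walk 4 (m * r ^ 2))) {x. (\<Sum>i\<in>K. a i * x i) = 0} \<le>
    2 * \<tau> + 2 / real (j + 1) * measure_pmf.prob (Pi_pmf K 0 (\<lambda>_. walk 8 m)) {x. (\<Sum>i\<in>K. a i * x i) = 0}"
proof -
  define B where "B = (\<Sum>i\<in>K. \<bar>a i\<bar>) * int (m * r ^ 2)"
  have "eventually (\<lambda>N. exp (- (real m * real r ^ 2) * lattice_defect N K a 1) \<ge> 1 / 2 \<and> N > nat B) sequentially"
    using eventually_exp_lattice_defect[OF assms(1)] eventually_gt_at_top by (rule eventually_conj)
  then obtain N where N: "exp (- (real m * real r ^ 2) * lattice_defect N K a 1) \<ge> 1 / 2" "N > nat B"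
    by (auto simp: eventually_sequentially)
  have BN: "B < int N" "N > 0" using N(2) by linarith+
  have "1 \<le> r ^ 2" using r by simp
  hence m1: "m \<le> m * r ^ 2" by simp
  have "(\<Sum>i\<in>K. \<bar>a i\<bar>) * int m \<le> B"
    unfolding B_def using m1 by (intro mult_left_mono sum_nonneg) (auto simp del: of_nat_mult of_nat_power)
  hence Bm: "(\<Sum>i\<in>K. \<bar>a i\<bar>) * int m < int N" using BN by linarith
  have aN: "\<bar>a i\<bar> < int N" if "i \<in> K" for i
  proof -
    have "\<bar>a i\<bar> \<le> (\<Sum>i\<in>K. \<bar>a i\<bar>) * 1"
      using that assms(1) member_le_sum[of i K "\<lambda>i. \<bar>a i\<bar>"] by simp
    also have "\<dots> \<le> (\<Sum>i\<in>K. \<bar>a i\<bar>) * int m"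
      using assms(2) by (intro mult_left_mono sum_nonneg) auto
    finally show ?thesis using Bm by linarith
  qed
  obtain \<xi> where \<xi>: "lattice_defect N K a \<xi> \<ge> real (card {i\<in>K. a i \<noteq> 0}) / 2"
    using exists_large_lattice_defect[OF assms(1) BN(2), of a] aN by blast
  have "exp (- real m * lattice_defect N K a \<xi>) \<le> exp (- real m * (real (card {i\<in>K. a i \<noteq> 0}) / 2))"
    using mult_left_mono[OF \<xi>, of "real m"] by simp
  hence small': "exp (- real m * lattice_defect N K a \<xi>) < \<tau>" using small by linarith
  have "measure_pmf.prob (Pi_pmf K 0 (\<lambda>_. walk 4 (m * r ^ 2))) {x. (\<Sum>i\<in>K. a i * x i) = 0} \<le>
      (\<Sum>\<xi><N. exp (- real (m * r ^ 2) * lattice_defect N K a (int \<xi>))) / real N"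
    using BN by (intro prob_orth_walk4_le assms(1)) (auto simp: B_def)
  also have "\<dots> \<le> (2 * \<tau> * real N + 2 / real (j + 1) * (\<Sum>\<xi><N. exp (- real m * lattice_defect N K a (int \<xi>)))) / real N"
    using sum_exp_lattice_defect_le[OF assms(1) BN(2) _ tau r small' N(1)] assms(2)
    by (intro divide_right_mono) auto
  also have "\<dots> = 2 * \<tau> + 2 / real (j + 1) * ((\<Sum>\<xi><N. exp (- real m * lattice_defect N K a (int \<xi>))) / real N)"
    using BN by (simp add: add_divide_distrib)
  also have "\<dots> \<le> 2 * \<tau> + 2 / real (j + 1) *
      measure_pmf.prob (Pi_pmf K 0 (\<lambda>_. walk 8 m)) {x. (\<Sum>i\<in>K. a i * x i) = 0}"
    using BN Bm by (intro add_left_mono mult_left_mono prob_orth_walk8_ge assms(1)) auto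
  finally show ?thesis .
qed

text \<open>The growth estimate for one coordinate with \<mu> = r^2, whence r^4 = \<mu> r^2: then
  exp(-\<mu>/2) is below \<tau> = 1/(j + 1), and bounding the sum with the smaller exponent
  trivially by N leaves 4/(j + 1).\<close>

lemma pmf_walk_bound:
  assumes "L \<ge> 4" and r: "r = 3 * j + 2" and j: "j \<ge> 1" and n: "4 / real L * real n \<ge> real r ^ 4"
  shows "pmf (walk L n) z \<le> 4 / real (j + 1)"
proof -
  define \<tau> where "\<tau> = 1 / real (j + 1)"
  have tau: "0 < \<tau>" "\<tau> \<le> 1 / 2" using j by (auto simp: \<tau>_def field_simps)
  have "eventually (\<lambda>N. exp (- (real r ^ 2 * real r ^ 2) * lattice_defect N {0} (\<lambda>_. 1) 1) \<ge> 1 / 2 \<and> N > 2 * n + 1) sequentially"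
    using eventually_exp_lattice_defect eventually_gt_at_top by (intro eventually_conj) auto
  then obtain N where N: "exp (- (real r ^ 2 * real r ^ 2) * lattice_defect N {0} (\<lambda>_. 1) 1) \<ge> 1 / 2" "N > 2 * n + 1"
    by (auto simp: eventually_sequentially)
  have "N > 0" using N by simp
  then obtain \<xi> where \<xi>: "lattice_defect N {0} (\<lambda>_. 1) \<xi> \<ge> 1 / 2"
    using exists_large_lattice_defect[of "{0}" N "\<lambda>_. 1"] N by auto
  have "exp (- (real r ^ 2) * lattice_defect N {0} (\<lambda>_. 1) \<xi>) \<le> exp (- (real r ^ 2 / 2))"
    using mult_left_mono[OF \<xi>, of "real r ^ 2"] by simp
  also have "\<dots> = 1 / exp (real r ^ 2 / 2)" by (simp add: exp_minus field_simps)
  also have "\<dots> < \<tau>"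
  proof -
    have "real (j + 1) < 1 + real r ^ 2 / 2"
    proof -
      have "real r * 2 \<le> real r * real r" using r by (intro mult_left_mono) auto
      thus ?thesis using r by (simp add: power2_eq_square)
    qed
    also have "\<dots> \<le> exp (real r ^ 2 / 2)" by (rule exp_ge_add_one_self)
    finally show ?thesis by (simp add: \<tau>_def field_simps)
  qed
  finally have small: "exp (- (real r ^ 2) * lattice_defect N {0} (\<lambda>_. 1) \<xi>) < \<tau>" .
  have "pmf (walk L n) z \<le> (\<Sum>\<xi><N. exp (- (4 / real L * real n) * lattice_defect N {0} (\<lambda>_. 1) (int \<xi>))) / real N"
    using assms N by (intro pmf_walk_le) auto
  also have "\<dots> \<le> (\<Sum>\<xi><N. exp (- (real r ^ 2 * real r ^ 2) * lattice_defect N {0} (\<lambda>_. 1) (int \<xi>))) / real N"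
  proof (intro divide_right_mono sum_mono)
    fix \<xi>
    have "real r ^ 4 * lattice_defect N {0} (\<lambda>_. 1) (int \<xi>) \<le> 4 / real L * real n * lattice_defect N {0} (\<lambda>_. 1) (int \<xi>)"
      using n by (intro mult_right_mono lattice_defect_nonneg)
    thus "exp (- (4 / real L * real n) * lattice_defect N {0} (\<lambda>_. 1) (int \<xi>)) \<le>
        exp (- (real r ^ 2 * real r ^ 2) * lattice_defect N {0} (\<lambda>_. 1) (int \<xi>))"
      by (simp flip: power_add)
  qed auto
  also have "\<dots> \<le> (2 * \<tau> * real N + 2 / real (j + 1) * (\<Sum>\<xi><N. exp (- (real r ^ 2) * lattice_defect N {0} (\<lambda>_. 1) (int \<xi>)))) / real N"
    using sum_exp_lattice_defect_le[OF _ \<open>N > 0\<close> _ tau r small N(1)] r by (intro divide_right_mono) auto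
  also have "\<dots> \<le> (2 * \<tau> * real N + 2 / real (j + 1) * (\<Sum>\<xi><N. 1)) / real N"
    by (intro divide_right_mono add_left_mono mult_left_mono sum_mono) (auto simp: lattice_defect_nonneg)
  also have "\<dots> = 4 / real (j + 1)"
    using \<open>N > 0\<close> by (simp add: \<tau>_def add_divide_distrib)
  finally show ?thesis .
qed

section \<open>The exchange argument\<close>

definition indep_in :: "(nat \<Rightarrow> real) set \<Rightarrow> nat \<Rightarrow> (nat \<Rightarrow> nat \<Rightarrow> int) \<Rightarrow> bool" where
  "indep_in V d y \<longleftrightarrow> inj_on (\<lambda>j. rvec (y j)) {..<d} \<and> vs.independent ((\<lambda>j. rvec (y j)) ` {..<d}) \<and>
     (\<lambda>j. rvec (y j)) ` {..<d} \<subseteq> V"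

text \<open>Columns are drawn one by one: the span of the earlier ones takes away at most half of
  the probability q of V, so each draw succeeds with probability at least q/2.\<close>

lemma prob_indep_in_ge:
  assumes "finite (set_pmf c)" and q: "q = measure_pmf.prob c {y. rvec y \<in> V}"
    and small: "\<And>T. finite T \<Longrightarrow> card T < d \<Longrightarrow> measure_pmf.prob c {y. rvec y \<in> vs.span T} \<le> q / 2"
  shows "measure_pmf.prob (Pi_pmf {..<d} z (\<lambda>_. c)) {y. indep_in V d y} \<ge> (q / 2) ^ d"
  using small
proof (induction d)
  case 0
  show ?case by (simp add: indep_in_def vs.independent_empty)
next
  case (Suc d)
  let ?P = "Pi_pmf {..<d} z (\<lambda>_. c)"
  let ?r = "\<lambda>y j. rvec (y j)"
  have "(q / 2) ^ Suc d = (q / 2) ^ d * (q / 2)" by simp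
  also have "\<dots> \<le> measure_pmf.prob ?P {y. indep_in V d y} * (q / 2)"
    using Suc.prems by (intro mult_right_mono Suc.IH) (auto simp: q)
  also have "\<dots> \<le> measure_pmf.prob (pair_pmf ?P (Pi_pmf {d} z (\<lambda>_. c)))
      {(f, g). indep_in V d f \<and> (rvec (g d) \<in> V \<and> rvec (g d) \<notin> vs.span (?r f ` {..<d}))}"
  proof (rule prob_pair_pmf_ge)
    show "finite (set_pmf ?P)" using assms(1) by (intro finite_set_Pi_pmf) auto
    fix f :: "nat \<Rightarrow> nat \<Rightarrow> int"
    let ?T = "?r f ` {..<d}"
    have "measure_pmf.prob c {y. rvec y \<in> V} \<le>
      measure_pmf.prob c ({y. rvec y \<in> V \<and> rvec y \<notin> vs.span ?T} \<union> {y. rvec y \<in> vs.span ?T})"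
      by (intro measure_pmf.finite_measure_mono) auto
    also have "\<dots> \<le> measure_pmf.prob c {y. rvec y \<in> V \<and> rvec y \<notin> vs.span ?T} +
        measure_pmf.prob c {y. rvec y \<in> vs.span ?T}"
      by (intro measure_Un_le) auto
    also have "measure_pmf.prob c {y. rvec y \<in> vs.span ?T} \<le> q / 2"
      using card_image_le[of "{..<d}" "?r f"] by (intro Suc.prems) auto
    finally have "q / 2 \<le> measure_pmf.prob c {y. rvec y \<in> V \<and> rvec y \<notin> vs.span ?T}"
      by (simp add: q)
    also have "\<dots> = measure_pmf.prob (Pi_pmf {d} z (\<lambda>_. c)) {g. rvec (g d) \<in> V \<and> rvec (g d) \<notin> vs.span ?T}"
      by (simp add: Pi_pmf_singleton vimage_def)
    finally show "q / 2 \<le> measure_pmf.prob (Pi_pmf {d} z (\<lambda>_. c)) {g. rvec (g d) \<in> V \<and> rvec (g d) \<notin> vs.span ?T}" .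
  qed
  also have "\<dots> \<le> measure_pmf.prob (pair_pmf ?P (Pi_pmf {d} z (\<lambda>_. c)))
      {(f, g). (\<lambda>x. if x \<in> {..<d} then f x else g x) \<in> {y. indep_in V (Suc d) y}}"
  proof (intro measure_pmf.finite_measure_mono subsetI, clarify)
    fix f g :: "nat \<Rightarrow> nat \<Rightarrow> int"
    assume fg: "indep_in V d f" "rvec (g d) \<in> V" "rvec (g d) \<notin> vs.span (?r f ` {..<d})"
    let ?y = "\<lambda>x. if x \<in> {..<d} then f x else g x"
    have im: "?r ?y ` {..<Suc d} = insert (rvec (g d)) (?r f ` {..<d})"
      by (auto simp: lessThan_Suc)
    have "rvec (g d) \<notin> ?r f ` {..<d}" using fg(3) by (rule contrapos_nn) (rule vs.span_base)
    moreover have "inj_on (?r f) {..<d}" using fg(1) by (simp add: indep_in_def)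
    hence "inj_on (?r ?y) {..<d}" by (subst inj_on_cong[where g = "?r f"]) auto
    moreover have "?r ?y ` {..<d} = ?r f ` {..<d}" by auto
    ultimately have "inj_on (?r ?y) {..<Suc d}"
      by (simp add: lessThan_Suc)
    moreover have "vs.independent (insert (rvec (g d)) (?r f ` {..<d}))"
      using vs.independent_insertI[OF fg(3)] fg(1) by (simp add: indep_in_def)
    ultimately show "indep_in V (Suc d) ?y"
      unfolding indep_in_def im using fg(1,2) by (auto simp: indep_in_def)
  qed auto
  also have "\<dots> = measure_pmf.prob (Pi_pmf {..<Suc d} z (\<lambda>_. c)) {y. indep_in V (Suc d) y}"
    by (rule prob_Pi_pmf_split[symmetric]) auto
  finally show ?case .
qed

text \<open>Steinitz exchange: the independent family y is completed to a basis of V by some of the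
  generating columns x, namely those indexed by S.\<close>

lemma exchange_into_family:
  assumes "finite J" "indep_in V d y" and x: "vs.span ((\<lambda>j. rvec (x j)) ` J) = V"
  shows "\<exists>S\<subseteq>J. card S = vs.dim V - d \<and> vs.span ((\<lambda>j. rvec (y j)) ` {..<d} \<union> (\<lambda>j. rvec (x j)) ` S) = V"
proof -
  let ?X = "(\<lambda>j. rvec (x j)) ` J" and ?Y = "(\<lambda>j. rvec (y j)) ` {..<d}"
  have Y: "vs.independent ?Y" "?Y \<subseteq> V" "card ?Y = d"
    using assms(2) by (auto simp: indep_in_def card_image)
  obtain B where B: "?Y \<subseteq> B" "B \<subseteq> ?Y \<union> ?X" "vs.independent B" "?Y \<union> ?X \<subseteq> vs.span B"
    by (rule vs.maximal_independent_subset_extend[of ?Y "?Y \<union> ?X"]) (use Y in auto)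
  have "V \<subseteq> vs.span B"
    unfolding x[symmetric] using B(4) by (intro vs.span_minimal vs.subspace_span) auto
  moreover have "vs.span B \<subseteq> V"
  proof (rule vs.span_minimal)
    have "?X \<subseteq> V" using vs.span_superset[of ?X] unfolding x .
    thus "B \<subseteq> V" using B(2) Y(2) by blast
    show "vs.subspace V" unfolding x[symmetric] by (rule vs.subspace_span)
  qed
  ultimately have BV: "vs.span B = V" by auto
  hence "vs.dim V = card B"
    using B(3) vs.dim_span_eq_card_independent by metis
  have "B - ?Y \<subseteq> ?X" using B(2) by auto
  then obtain S where S: "S \<subseteq> J" "inj_on (\<lambda>j. rvec (x j)) S" "B - ?Y = (\<lambda>j. rvec (x j)) ` S"
    by (meson subset_image_inj)
  have "finite ?Y" by simp
  hence "card (B - ?Y) = card B - d" using B(1) Y(3) by (simp add: card_Diff_subset)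
  hence "card S = vs.dim V - d" using S \<open>vs.dim V = card B\<close> by (simp add: card_image)
  moreover have "?Y \<union> (\<lambda>j. rvec (x j)) ` S = B" using S(3) B(1) by auto
  ultimately show ?thesis using S(1) BV by (intro exI[of _ S]) auto
qed

text \<open>Drawing Y independently of X turns the product on the left into a joint event, to which
  \<open>exchange_into_family\<close> applies. Once Y and the columns in S span V, the remaining
  columns only have to lie in V, independently of the rest and of each other.\<close>

lemma prob_span_eq_swap:
  fixes cX cY :: "(nat \<Rightarrow> int) pmf" and z :: "nat \<Rightarrow> int" and J :: "'a set"
  assumes fin: "finite J" "finite (set_pmf cX)" "finite (set_pmf cY)"
    and V: "d \<le> vs.dim V" "vs.dim V < card J"
  defines "PX \<equiv> \<lambda>S. Pi_pmf S z (\<lambda>_. cX)" and "PY \<equiv> Pi_pmf {..<d} z (\<lambda>_. cY)"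
  shows "measure_pmf.prob PY {y. indep_in V d y} *
      measure_pmf.prob (PX J) {x. vs.span ((\<lambda>j. rvec (x j)) ` J) = V} \<le>
    (\<Sum>S | S \<subseteq> J \<and> card S = vs.dim V - d. measure_pmf.prob (pair_pmf PY (PX S))
       {(y, x). vs.span ((\<lambda>j. rvec (y j)) ` {..<d} \<union> (\<lambda>j. rvec (x j)) ` S) = V}) *
    measure_pmf.prob cX {x. rvec x \<in> V} ^ (d + 1)"
proof -
  let ?r = "\<lambda>y j. rvec (y j)"
  define p where "p = measure_pmf.prob cX {x. rvec x \<in> V}"
  define SS where "SS = {S. S \<subseteq> J \<and> card S = vs.dim V - d}"
  have p: "0 \<le> p" "p \<le> 1" by (auto simp: p_def)
  have finPY: "finite (set_pmf PY)" unfolding PY_def using fin by (intro finite_set_Pi_pmf) auto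
  have finPX: "finite (set_pmf (PX S))" if "S \<subseteq> J" for S
    unfolding PX_def using fin that finite_subset by (intro finite_set_Pi_pmf) auto
  have "finite SS" unfolding SS_def using fin by auto
  define E where "E S = {(y, x). vs.span (?r y ` {..<d} \<union> ?r x ` S) = V \<and> (\<forall>j\<in>J - S. rvec (x j) \<in> V)}" for S
  have "measure_pmf.prob PY {y. indep_in V d y} * measure_pmf.prob (PX J) {x. vs.span (?r x ` J) = V} \<le>
    measure_pmf.prob (pair_pmf PY (PX J)) {(y, x). indep_in V d y \<and> vs.span (?r x ` J) = V}"
    by (rule prob_pair_pmf_ge[OF finPY]) auto
  also have "\<dots> \<le> measure_pmf.prob (pair_pmf PY (PX J)) (\<Union>S\<in>SS. E S)"
  proof (intro measure_pmf.finite_measure_mono subsetI)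
    fix w assume "w \<in> {(y, x). indep_in V d y \<and> vs.span (?r x ` J) = V}"
    then obtain y x where w: "w = (y, x)" and yx: "indep_in V d y" "vs.span (?r x ` J) = V"
      by auto
    then obtain S where S: "S \<subseteq> J" "card S = vs.dim V - d" "vs.span (?r y ` {..<d} \<union> ?r x ` S) = V"
      using exchange_into_family[OF fin(1)] by metis
    moreover have "rvec (x j) \<in> V" if "j \<in> J" for j
      unfolding yx(2)[symmetric] using that by (intro vs.span_base) auto
    ultimately show "w \<in> (\<Union>S\<in>SS. E S)" unfolding w by (auto simp: SS_def E_def)
  qed auto
  also have "\<dots> \<le> (\<Sum>S\<in>SS. measure_pmf.prob (pair_pmf PY (PX J)) (E S))"
    using \<open>finite SS\<close> by (intro measure_pmf.finite_measure_subadditive_finite) auto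
  also have "\<dots> \<le> (\<Sum>S\<in>SS. measure_pmf.prob (pair_pmf PY (PX S))
       {(y, x). vs.span (?r y ` {..<d} \<union> ?r x ` S) = V} * p ^ (d + 1))"
  proof (rule sum_mono)
    fix S assume S: "S \<in> SS"
    define D where "D = J - S"
    have SD: "finite S" "finite D" "S \<inter> D = {}" "S \<union> D = J"
      using S fin finite_subset by (auto simp: SS_def D_def)
    \<comment> \<open>Only \<open>vs.dim V - d\<close> columns are in S, and the family has more
      than \<open>vs.dim V\<close> members.\<close>
    have cD: "d + 1 \<le> card D"
      using S V fin SD card_Diff_subset[of S J] by (auto simp: SS_def D_def)
    have *: "measure_pmf.prob (PX J) {x. (y, x) \<in> E S} \<le>
      measure_pmf.prob (PX S) {x. vs.span (?r y ` {..<d} \<union> ?r x ` S) = V} * p ^ (d + 1)" for y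
    proof -
      let ?g = "\<lambda>(f :: 'a \<Rightarrow> nat \<Rightarrow> int) g x. if x \<in> S then f x else g x"
      have "(?g f g \<in> {x. (y, x) \<in> E S}) = (vs.span (?r y ` {..<d} \<union> ?r f ` S) = V \<and> (\<forall>j\<in>D. rvec (g j) \<in> V))" for f g
      proof -
        have "?r (?g f g) ` S = ?r f ` S" by auto
        thus ?thesis by (auto simp: E_def D_def)
      qed
      hence "measure_pmf.prob (PX J) {x. (y, x) \<in> E S} = measure_pmf.prob (pair_pmf (PX S) (PX D))
          {(f, g). vs.span (?r y ` {..<d} \<union> ?r f ` S) = V \<and> (\<forall>j\<in>D. rvec (g j) \<in> V)}"
        unfolding PX_def by (subst prob_Pi_pmf_split[OF SD]) simp
      also have "\<dots> \<le> measure_pmf.prob (PX S) {f. vs.span (?r y ` {..<d} \<union> ?r f ` S) = V} * p ^ (d + 1)"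
      proof (rule prob_pair_pmf_le)
        have "{g. \<forall>j\<in>D. rvec (g j) \<in> V} = Pi D (\<lambda>_. {x. rvec x \<in> V})" by auto
        hence "measure_pmf.prob (PX D) {g. \<forall>j\<in>D. rvec (g j) \<in> V} = p ^ card D"
          unfolding PX_def using SD by (simp only: measure_Pi_pmf_Pi) (simp add: p_def)
        thus "measure_pmf.prob (PX D) {g. \<forall>j\<in>D. rvec (g j) \<in> V} \<le> p ^ (d + 1)"
          using power_decreasing[OF cD p] by simp
      qed (use S in \<open>auto simp: SS_def intro!: finPX\<close>)
      finally show ?thesis .
    qed
    have "measure_pmf.prob (pair_pmf PY (PX J)) (E S) =
        (\<Sum>y\<in>set_pmf PY. pmf PY y * measure_pmf.prob (PX J) {x. (y, x) \<in> E S})"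
      using prob_pair_pmf[OF finPY, of "PX J" "\<lambda>y x. (y, x) \<in> E S"] by simp
    also have "\<dots> \<le> (\<Sum>y\<in>set_pmf PY. pmf PY y *
        (measure_pmf.prob (PX S) {x. vs.span (?r y ` {..<d} \<union> ?r x ` S) = V} * p ^ (d + 1)))"
      by (intro sum_mono mult_left_mono *) auto
    also have "\<dots> = measure_pmf.prob (pair_pmf PY (PX S))
       {(y, x). vs.span (?r y ` {..<d} \<union> ?r x ` S) = V} * p ^ (d + 1)"
      by (subst prob_pair_pmf[OF finPY]) (simp add: sum_distrib_right mult.assoc)
    finally show "measure_pmf.prob (pair_pmf PY (PX J)) (E S) \<le> measure_pmf.prob (pair_pmf PY (PX S))
       {(y, x). vs.span (?r y ` {..<d} \<union> ?r x ` S) = V} * p ^ (d + 1)" .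
  qed
  finally show ?thesis by (simp add: SS_def p_def sum_distrib_right)
qed

lemma sum_prob_fibres_le_1:
  assumes "finite \<V>"
  shows "(\<Sum>V\<in>\<V>. measure_pmf.prob M {w. F w = V}) \<le> 1"
proof -
  have "(\<Sum>V\<in>\<V>. measure_pmf.prob M {w. F w = V}) = measure_pmf.prob M (\<Union>V\<in>\<V>. {w. F w = V})"
    using assms by (intro measure_pmf.finite_measure_finite_Union[symmetric]) (auto simp: disjoint_family_on_def)
  thus ?thesis by simp
qed

text \<open>Dividing the swap inequality by the probability that Y is independent in V leaves c
  times probabilities that a span equals V. For fixed S these events are disjoint over V, so the
  number of subspaces does not matter; only the choice of S, at most \<open>2 ^ card J\<close>, is
  paid for.\<close>

lemma prob_span_in_le:
  fixes cX cY :: "(nat \<Rightarrow> int) pmf" and z :: "nat \<Rightarrow> int" and J :: "'a set"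
  assumes fin: "finite J" "finite (set_pmf cX)" "finite (set_pmf cY)" and c: "0 \<le> c"
    and dim: "\<And>V. V \<in> \<V> \<Longrightarrow> d \<le> vs.dim V \<and> vs.dim V < card J"
    and pos: "\<And>V. V \<in> \<V> \<Longrightarrow> 0 < measure_pmf.prob (Pi_pmf {..<d} z (\<lambda>_. cY)) {y. indep_in V d y}"
    and le: "\<And>V. V \<in> \<V> \<Longrightarrow> measure_pmf.prob cX {x. rvec x \<in> V} ^ (d + 1) \<le>
      c * measure_pmf.prob (Pi_pmf {..<d} z (\<lambda>_. cY)) {y. indep_in V d y}"
  shows "measure_pmf.prob (Pi_pmf J z (\<lambda>_. cX)) {x. vs.span ((\<lambda>j. rvec (x j)) ` J) \<in> \<V>} \<le> c * 2 ^ card J"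
proof -
  let ?r = "\<lambda>y j. rvec (y j)"
  let ?PX = "\<lambda>S. Pi_pmf S z (\<lambda>_. cX)" and ?PY = "Pi_pmf {..<d} z (\<lambda>_. cY)"
  have finP: "finite (set_pmf (?PX J))" using fin by (intro finite_set_Pi_pmf)
  \<comment> \<open>Only subspaces attained as spans matter, and these are finitely many.\<close>
  define \<W> where "\<W> = \<V> \<inter> (\<lambda>x. vs.span (?r x ` J)) ` set_pmf (?PX J)"
  have "finite \<W>" using finP by (simp add: \<W>_def)
  define R where "R (S :: 'a set) V = measure_pmf.prob (pair_pmf ?PY (?PX S))
       {(y, x). vs.span (?r y ` {..<d} \<union> ?r x ` S) = V}" for S V
  have A: "measure_pmf.prob (?PX J) {x. vs.span (?r x ` J) = V} \<le> c * (\<Sum>S\<in>Pow J. R S V)" if "V \<in> \<W>" for V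
  proof -
    have V: "V \<in> \<V>" using that by (simp add: \<W>_def)
    define Q where "Q = measure_pmf.prob ?PY {y. indep_in V d y}"
    have Q: "0 < Q" using pos[OF V] by (simp add: Q_def)
    have "Q * measure_pmf.prob (?PX J) {x. vs.span (?r x ` J) = V} \<le>
      (\<Sum>S | S \<subseteq> J \<and> card S = vs.dim V - d. R S V) * measure_pmf.prob cX {x. rvec x \<in> V} ^ (d + 1)"
      unfolding Q_def R_def using fin dim[OF V] by (intro prob_span_eq_swap) auto
    also have "\<dots> \<le> (\<Sum>S\<in>Pow J. R S V) * (c * Q)"
    proof (intro mult_mono)
      show "(\<Sum>S | S \<subseteq> J \<and> card S = vs.dim V - d. R S V) \<le> (\<Sum>S\<in>Pow J. R S V)"
        using fin by (intro sum_mono2) (auto simp: R_def)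
    qed (use le[OF V] in \<open>auto simp: Q_def R_def intro!: sum_nonneg\<close>)
    finally have "Q * measure_pmf.prob (?PX J) {x. vs.span (?r x ` J) = V} \<le> Q * (c * (\<Sum>S\<in>Pow J. R S V))"
      by (simp add: mult_ac)
    thus ?thesis using Q by simp
  qed
  have "measure_pmf.prob (?PX J) {x. vs.span (?r x ` J) \<in> \<V>} =
      measure_pmf.prob (?PX J) (\<Union>V\<in>\<W>. {x. vs.span (?r x ` J) = V})"
    by (intro measure_pmf.finite_measure_eq_AE) (auto simp: AE_measure_pmf_iff \<W>_def)
  also have "\<dots> \<le> (\<Sum>V\<in>\<W>. measure_pmf.prob (?PX J) {x. vs.span (?r x ` J) = V})"
    using \<open>finite \<W>\<close> by (intro measure_pmf.finite_measure_subadditive_finite) auto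
  also have "\<dots> \<le> (\<Sum>V\<in>\<W>. c * (\<Sum>S\<in>Pow J. R S V))"
    by (intro sum_mono A)
  also have "\<dots> = c * (\<Sum>S\<in>Pow J. \<Sum>V\<in>\<W>. R S V)"
    by (simp add: sum_distrib_left[symmetric] sum.swap[of _ \<W>])
  also have "\<dots> \<le> c * (\<Sum>S\<in>Pow J. 1)"
  proof (intro mult_left_mono sum_mono c)
    fix S
    show "(\<Sum>V\<in>\<W>. R S V) \<le> 1"
      using sum_prob_fibres_le_1[OF \<open>finite \<W>\<close>, of "pair_pmf ?PY (?PX S)"
          "\<lambda>(y, x). vs.span (?r y ` {..<d} \<union> ?r x ` S)"] by (simp add: R_def case_prod_unfold)
  qed
  also have "\<dots> = c * 2 ^ card J" using fin by (simp add: card_Pow)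
  finally show ?thesis .
qed

section \<open>Existence of MDS matrices\<close>

lemma rvec_in_vecs_Pi_pmf:
  assumes "x \<in> set_pmf (Pi_pmf K 0 p)" "finite K"
  shows "rvec x \<in> vecs K"
  using set_Pi_pmf_subset[OF assms(2), of 0 p] assms(1) by (auto simp: rvec_def vecs_def)

lemma dim_less_of_orth:
  fixes a :: "nat \<Rightarrow> real"
  assumes "finite I" "S \<subseteq> vecs I" "\<And>v. v \<in> S \<Longrightarrow> (\<Sum>i\<in>I. a i * v i) = 0" "i \<in> I" "a i \<noteq> 0"
  shows "vs.dim S < card I"
proof -
  obtain B where B: "B \<subseteq> S" "vs.independent B" "S \<subseteq> vs.span B" "card B = vs.dim S"
    by (rule vs.basis_exists)
  have "finite B \<and> card B < card I"
    using assms B(1,2) by (intro independent_orth[of I B a i]) auto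
  thus ?thesis using B(4) by simp
qed

lemma prob_rank_eq_le:
  fixes J :: "'a set" and z :: "nat \<Rightarrow> int"
  assumes J: "finite J" "card J = k" and k: "k \<ge> 2" and j: "j \<ge> 7" and r: "r = 3 * j + 2"
  defines "\<rho> \<equiv> 4 / real (j + 1)"
  shows "measure_pmf.prob (Pi_pmf J z (\<lambda>_. Pi_pmf {..<k} 0 (\<lambda>_. walk 4 (2 * r ^ 4 * r ^ 2))))
    {x. vs.dim ((\<lambda>j. rvec (x j)) ` J) = k - 1} \<le> 4 * 4 ^ k * \<rho> ^ (k div 2)"
proof -
  \<comment> \<open>Sparse normals and improbable hyperplanes contribute \<rho> to the power k - d,
    the swap contributes \<rho> to the power d; halving balances them.\<close>
  define d where "d = k div 2"
  define e where "e = k - d"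
  have de: "d \<le> e" "1 \<le> d" "d \<le> k - 1" "d + e = k" using k by (auto simp: d_def e_def)
  have rho: "0 < \<rho>" "\<rho> \<le> 1" using j by (auto simp: \<rho>_def)
  define px where "px = walk 4 (2 * r ^ 4 * r ^ 2)"
  define py where "py = walk 8 (2 * r ^ 4)"
  define cX where "cX = Pi_pmf {..<k} 0 (\<lambda>_. px)"
  define cY where "cY = Pi_pmf {..<k} 0 (\<lambda>_. py)"
  let ?r = "\<lambda>y j. rvec (y j)"
  let ?PX = "Pi_pmf J z (\<lambda>_. cX)"
  have finp: "finite (set_pmf px)" "finite (set_pmf py)"
    by (auto simp: px_def py_def intro!: finite_set_walk)
  hence fin: "finite (set_pmf cX)" "finite (set_pmf cY)"
    by (auto simp: cX_def cY_def intro!: finite_set_Pi_pmf)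
  have "1 \<le> real r ^ 2" using r by simp
  hence "real r ^ 4 * 1 \<le> real r ^ 4 * (2 * real r ^ 2)" by (intro mult_left_mono) auto
  hence px: "pmf px y \<le> \<rho>" for y
    unfolding px_def \<rho>_def using j r by (intro pmf_walk_bound) auto
  have py: "pmf py y \<le> \<rho>" for y
    unfolding py_def \<rho>_def using j r by (intro pmf_walk_bound) auto
  \<comment> \<open>A subspace of dimension below d contains a column Y with probability at most
    \<rho>^e; the factor 2 makes this at most half of \<open>q V\<close> once
    \<open>q V \<ge> \<theta>\<close>, as \<open>prob_indep_in_ge\<close> requires.\<close>
  define \<theta> where "\<theta> = 2 * \<rho> ^ e"
  have theta: "0 < \<theta>" "\<theta> / 4 \<le> 1 / 2" using rho by (auto simp: \<theta>_def power_le_one)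
  define normal where "normal V a \<longleftrightarrow> (\<forall>i\<ge>k. a i = 0) \<and> (\<exists>i<k. a i \<noteq> 0) \<and> V = hyp k a" for V a
  define nnz where "nnz a = card {i\<in>{..<k}. a i \<noteq> (0::int)}" for a
  define p where "p V = measure_pmf.prob cX {x. rvec x \<in> V}" for V
  define q where "q V = measure_pmf.prob cY {x. rvec x \<in> V}" for V
  define \<V> where "\<V> = {V. vs.dim V = k - 1 \<and> (\<exists>a. normal V a \<and> nnz a > d)}"
  define low where "low = {V \<in> \<V>. p V \<le> \<theta>}"
  define high where "high = {V \<in> \<V>. p V > \<theta>}"
  define sparse where "sparse I = {x. vs.dim ((\<lambda>j. rvec (restr I (x j))) ` J) < card I}"
    for I and x :: "'a \<Rightarrow> nat \<Rightarrow> int"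
  define II where "II = {I. I \<subseteq> {..<k} \<and> card I \<le> d}"
  have "finite II" by (auto simp: II_def)

  have orth_iff: "measure_pmf.prob (Pi_pmf {..<k} 0 (\<lambda>_. w)) {x. rvec x \<in> hyp k a} =
    measure_pmf.prob (Pi_pmf {..<k} 0 (\<lambda>_. w)) {x. (\<Sum>i<k. a i * x i) = 0}" for w a
    by (intro measure_pmf.finite_measure_eq_AE)
      (auto simp: AE_measure_pmf_iff rvec_in_hyp_iff rvec_in_vecs_Pi_pmf)

  have cmp: "p V \<le> \<theta> / 2 + 2 / real (j + 1) * q V" if V: "V \<in> \<V>" for V
  proof -
    from V obtain a where a: "normal V a" "nnz a > d" by (auto simp: \<V>_def)
    \<comment> \<open>The comparison is applied with \<tau> = \<theta>/4. A support of at least k/2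
      entries gives the k-th power of exp(-r^4/2) on the left, and the right side \<rho>^e/2 is at
      least (\<rho>/2)^k.\<close>
    have "exp (- real (2 * r ^ 4) * (real (nnz a) / 2)) < \<theta> / 4"
    proof -
      have "real k / 2 \<le> real (nnz a)" using a(2) by (simp add: d_def)
      hence "real r ^ 4 * (real k / 2) \<le> real r ^ 4 * real (nnz a)" by (intro mult_left_mono) auto
      hence "exp (- real (2 * r ^ 4) * (real (nnz a) / 2)) \<le> exp (- (real r ^ 4 / 2)) ^ k"
        by (simp add: exp_of_nat_mult[symmetric] algebra_simps)
      also have "\<dots> < (\<rho> / 2) ^ k"
      proof (rule power_strict_mono)
        have "real (j + 1) / 2 < 1 + real r ^ 4 / 2"
        proof -
          have "real r ^ 1 \<le> real r ^ 4" using r by (intro power_increasing) auto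
          thus ?thesis using r by simp
        qed
        also have "\<dots> \<le> exp (real r ^ 4 / 2)" by (rule exp_ge_add_one_self)
        finally show "exp (- (real r ^ 4 / 2)) < \<rho> / 2"
          by (simp add: \<rho>_def exp_minus field_simps)
      qed (use k in auto)
      also have "\<dots> = \<rho> ^ k / 2 ^ k" by (simp add: power_divide)
      also have "\<dots> \<le> \<rho> ^ e / 2 ^ 1"
        using rho k de by (intro frac_le power_decreasing power_increasing) auto
      finally show ?thesis by (simp add: \<theta>_def)
    qed
    hence "measure_pmf.prob cX {x. (\<Sum>i<k. a i * x i) = 0} \<le>
        2 * (\<theta> / 4) + 2 / real (j + 1) * measure_pmf.prob cY {x. (\<Sum>i<k. a i * x i) = 0}"
      unfolding cX_def cY_def px_def py_def using theta r
      by (intro prob_orth_comparison) (auto simp: nnz_def)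
    moreover have "V = hyp k a" using a(1) by (simp add: normal_def)
    ultimately show ?thesis
      unfolding p_def q_def cX_def cY_def by (simp add: orth_iff)
  qed

  have "measure_pmf.prob ?PX {x. vs.dim (?r x ` J) = k - 1} \<le>
    measure_pmf.prob ?PX ((\<Union>I\<in>II. sparse I) \<union> ({x. vs.span (?r x ` J) \<in> low} \<union> {x. vs.span (?r x ` J) \<in> high}))"
  proof (rule measure_pmf.finite_measure_mono_AE)
    show "AE x in ?PX. x \<in> {x. vs.dim (?r x ` J) = k - 1} \<longrightarrow>
      x \<in> (\<Union>I\<in>II. sparse I) \<union> ({x. vs.span (?r x ` J) \<in> low} \<union> {x. vs.span (?r x ` J) \<in> high})"
      unfolding AE_measure_pmf_iff
    proof (intro ballI impI)
      fix x assume x: "x \<in> set_pmf ?PX" "x \<in> {x. vs.dim (?r x ` J) = k - 1}"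
      have xv: "?r x ` J \<subseteq> vecs {..<k}"
      proof clarify
        fix j assume "j \<in> J"
        hence "x j \<in> set_pmf cX" using x(1) J(1) by (auto simp: set_Pi_pmf PiE_dflt_def)
        thus "rvec (x j) \<in> vecs {..<k}" unfolding cX_def by (rule rvec_in_vecs_Pi_pmf) simp
      qed
      define V where "V = vs.span (?r x ` J)"
      have dimV: "vs.dim V = k - 1" using x(2) by (simp add: V_def)
      obtain B where B: "B \<subseteq> ?r x ` J" "vs.independent B" "?r x ` J \<subseteq> vs.span B"
        "card B = vs.dim (?r x ` J)"
        by (rule vs.basis_exists)
      have "vs.span B = V"
        unfolding V_def by (rule vs.span_eq[THEN iffD2]) (use B(1,3) vs.span_superset[of "?r x ` J"] in blast)
      moreover have "\<exists>a. (\<forall>i\<ge>k. a i = 0) \<and> (\<exists>i<k. a i \<noteq> 0) \<and> vs.span B = hyp k a"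
        using B x(2) xv k by (intro span_eq_hyp) auto
      ultimately obtain a where a: "normal V a" by (auto simp: normal_def)
      show "x \<in> (\<Union>I\<in>II. sparse I) \<union> ({x. vs.span (?r x ` J) \<in> low} \<union> {x. vs.span (?r x ` J) \<in> high})"
      proof (cases "nnz a > d")
        case True
        hence "V \<in> \<V>" using a dimV by (auto simp: \<V>_def)
        thus ?thesis by (auto simp: low_def high_def V_def)
      next
        case False
        \<comment> \<open>The normal lives on the small set I, so the columns satisfy a linear
          relation already after restriction to I.\<close>
        define I where "I = {i\<in>{..<k}. a i \<noteq> 0}"
        from a obtain i where i: "i < k" "a i \<noteq> 0" by (auto simp: normal_def)
        have "vs.dim ((\<lambda>j. rvec (restr I (x j))) ` J) < card I"
        proof (rule dim_less_of_orth[where a = "\<lambda>i. real_of_int (a i)"])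
          fix v assume "v \<in> (\<lambda>j. rvec (restr I (x j))) ` J"
          then obtain l where l: "l \<in> J" "v = rvec (restr I (x l))" by auto
          have "rvec (x l) \<in> V" unfolding V_def using l by (intro vs.span_base) auto
          hence "(\<Sum>i<k. real_of_int (a i) * rvec (x l) i) = 0"
            using a by (auto simp: normal_def hyp_def)
          also have "(\<Sum>i<k. real_of_int (a i) * rvec (x l) i) = (\<Sum>i\<in>I. real_of_int (a i) * v i)"
            by (intro sum.mono_neutral_cong_right) (auto simp: I_def l rvec_def restr_def)
          finally show "(\<Sum>i\<in>I. real_of_int (a i) * v i) = 0" .
        qed (use i in \<open>auto simp: I_def vecs_def rvec_def restr_def\<close>)
        moreover have "I \<in> II" using False by (auto simp: II_def I_def nnz_def)
        ultimately show ?thesis by (auto simp: sparse_def)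
      qed
    qed
  qed auto
  also have "\<dots> \<le> measure_pmf.prob ?PX (\<Union>I\<in>II. sparse I) +
      (measure_pmf.prob ?PX {x. vs.span (?r x ` J) \<in> low} + measure_pmf.prob ?PX {x. vs.span (?r x ` J) \<in> high})"
    by (intro order.trans[OF measure_Un_le] add_left_mono measure_Un_le) auto
  also have "measure_pmf.prob ?PX (\<Union>I\<in>II. sparse I) \<le> 4 ^ k * \<rho> ^ d"
  proof -
    have "measure_pmf.prob ?PX (\<Union>I\<in>II. sparse I) \<le> (\<Sum>I\<in>II. measure_pmf.prob ?PX (sparse I))"
      using \<open>finite II\<close> by (intro measure_pmf.finite_measure_subadditive_finite) auto
    also have "\<dots> \<le> (\<Sum>I\<in>II. 2 ^ k * \<rho> ^ d)"
    proof (rule sum_mono)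
      fix I assume I: "I \<in> II"
      have "measure_pmf.prob ?PX (sparse I) \<le> 2 ^ card J * \<rho> ^ (card J - card I)"
        unfolding sparse_def cX_def using I J finp px rho
        by (intro prob_rank_deficient_le) (auto simp: II_def)
      also have "\<dots> \<le> 2 ^ k * \<rho> ^ d"
        unfolding J(2) using I de rho by (intro mult_left_mono power_decreasing) (auto simp: II_def)
      finally show "measure_pmf.prob ?PX (sparse I) \<le> 2 ^ k * \<rho> ^ d" .
    qed
    also have "\<dots> = real (card II) * (2 ^ k * \<rho> ^ d)" by simp
    also have "\<dots> \<le> 2 ^ k * (2 ^ k * \<rho> ^ d)"
    proof (rule mult_right_mono)
      have "card II \<le> card (Pow {..<k})" by (intro card_mono) (auto simp: II_def)
      thus "real (card II) \<le> 2 ^ k"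
        by (metis card_Pow finite_lessThan card_lessThan of_nat_le_iff of_nat_numeral of_nat_power)
    qed (use rho in auto)
    also have "\<dots> = 4 ^ k * \<rho> ^ d" by (simp add: mult.assoc[symmetric] flip: power_mult_distrib)
    finally show ?thesis .
  qed
  also have "measure_pmf.prob ?PX {x. vs.span (?r x ` J) \<in> low} \<le> 2 * 4 ^ k * \<rho> ^ d"
  proof -
    \<comment> \<open>With d = 0 the family Y is empty and always independent; the gain \<theta>
      comes from the one column beyond a basis of V.\<close>
    have "measure_pmf.prob ?PX {x. vs.span (?r x ` J) \<in> low} \<le> \<theta> * 2 ^ card J"
      by (rule prob_span_in_le[where cY = cX and d = 0])
        (use J fin theta k in \<open>auto simp: low_def \<V>_def p_def indep_in_def vs.independent_empty\<close>)
    also have "\<dots> = 2 * 2 ^ k * \<rho> ^ e" by (simp add: J \<theta>_def)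
    also have "\<dots> \<le> 2 * 4 ^ k * \<rho> ^ d"
      using rho de by (intro mult_mono power_decreasing power_mono) auto
    finally show ?thesis .
  qed
  also have "measure_pmf.prob ?PX {x. vs.span (?r x ` J) \<in> high} \<le> 4 ^ k * \<rho> ^ d"
  proof -
    \<comment> \<open>As \<open>p V > \<theta>\<close>, the error \<theta>/2 is less than half of
      \<open>p V\<close>; absorbing it doubles 2/(j + 1) to 4/(j + 1), which is \<rho>.\<close>
    have hq: "p V \<le> \<rho> * q V \<and> \<theta> \<le> q V" if V: "V \<in> high" for V
    proof -
      have pV: "p V > \<theta>" "V \<in> \<V>" using V by (auto simp: high_def)
      from cmp[OF pV(2)] pV(1) have 1: "p V \<le> \<rho> * q V" by (simp add: \<rho>_def)
      also have "\<dots> \<le> 1 * q V" using rho by (intro mult_right_mono) (auto simp: q_def)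
      finally show ?thesis using pV 1 by auto
    qed
    have Q: "(q V / 2) ^ d \<le> measure_pmf.prob (Pi_pmf {..<d} z (\<lambda>_. cY)) {y. indep_in V d y}" if V: "V \<in> high" for V
    proof (rule prob_indep_in_ge)
      fix T :: "(nat \<Rightarrow> real) set" assume T: "finite T" "card T < d"
      have "measure_pmf.prob cY {y. rvec y \<in> vs.span T} \<le> \<rho> ^ (card {..<k} - card T)"
        unfolding cY_def using T finp py rho by (intro prob_in_span_le) auto
      also have "\<dots> \<le> \<rho> ^ e" using T rho de by (intro power_decreasing) auto
      also have "\<dots> \<le> q V / 2" using hq[OF V] by (simp add: \<theta>_def)
      finally show "measure_pmf.prob cY {y. rvec y \<in> vs.span T} \<le> q V / 2" .
    qed (use fin in \<open>auto simp: q_def\<close>)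
    have "measure_pmf.prob ?PX {x. vs.span (?r x ` J) \<in> high} \<le> (2 * \<rho>) ^ d * 2 ^ card J"
    proof (rule prob_span_in_le[where cY = cY and d = d])
      fix V assume V: "V \<in> high"
      show "d \<le> vs.dim V \<and> vs.dim V < card J" using V de k J by (auto simp: high_def \<V>_def)
      have "0 < q V" using hq[OF V] theta by linarith
      hence "0 < (q V / 2) ^ d" by simp
      with Q[OF V] show "0 < measure_pmf.prob (Pi_pmf {..<d} z (\<lambda>_. cY)) {y. indep_in V d y}"
        by linarith
      \<comment> \<open>One of the d + 1 factors is given away; each of the others gains 2\<rho>
        against a factor \<open>q V / 2\<close>.\<close>
      have "p V ^ (d + 1) \<le> p V ^ d" by (intro power_decreasing) (auto simp: p_def)
      also have "\<dots> \<le> (\<rho> * q V) ^ d" using hq[OF V] by (intro power_mono) (auto simp: p_def)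
      also have "\<dots> = (2 * \<rho>) ^ d * (q V / 2) ^ d" by (subst power_mult_distrib[symmetric]) simp
      also have "\<dots> \<le> (2 * \<rho>) ^ d * measure_pmf.prob (Pi_pmf {..<d} z (\<lambda>_. cY)) {y. indep_in V d y}"
        using Q[OF V] rho by (intro mult_left_mono) auto
      finally show "measure_pmf.prob cX {x. rvec x \<in> V} ^ (d + 1) \<le> \<dots>" unfolding p_def .
    qed (use J fin rho in auto)
    also have "\<dots> = 2 ^ d * 2 ^ k * \<rho> ^ d" by (simp add: J power_mult_distrib)
    also have "\<dots> \<le> 2 ^ k * 2 ^ k * \<rho> ^ d"
      using rho de by (intro mult_right_mono power_increasing) auto
    also have "\<dots> = 4 ^ k * \<rho> ^ d" by (simp flip: power_mult_distrib)
    finally show ?thesis .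
  qed
  finally show ?thesis by (simp add: cX_def px_def d_def algebra_simps)
qed

text \<open>Take a deficient k-set of maximal rank. Its rank is below k - 1, so it has a redundant
  column, while some column of J lies outside its span. Trading one for the other raises the rank by
  exactly one, so the new set is still deficient, against maximality.\<close>

lemma all_bases_of_no_corank_one:
  fixes v :: "'a \<Rightarrow> nat \<Rightarrow> real"
  assumes J: "finite J" "vs.dim (v ` J) \<ge> k" and k: "k \<ge> 1"
    and no: "\<And>S. S \<subseteq> J \<Longrightarrow> card S = k \<Longrightarrow> vs.dim (v ` S) \<noteq> k - 1"
    and S: "S \<subseteq> J" "card S = k"
  shows "vs.dim (v ` S) \<ge> k"
proof (rule ccontr)
  define bad where "bad S \<longleftrightarrow> S \<subseteq> J \<and> card S = k \<and> vs.dim (v ` S) < k" for S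
  assume "\<not> ?thesis"
  hence "bad S" using S by (simp add: bad_def)
  obtain S where badS: "bad S" and max: "\<And>S'. bad S' \<Longrightarrow> vs.dim (v ` S') \<le> vs.dim (v ` S)"
    using ex_has_greatest_nat[of bad S "\<lambda>S. vs.dim (v ` S)" k] \<open>bad S\<close> by (auto simp: bad_def)
  have SJ: "S \<subseteq> J" "card S = k" "vs.dim (v ` S) < k - 1"
    using badS no[of S] by (auto simp: bad_def)
  obtain B where B: "B \<subseteq> v ` S" "vs.independent B" "v ` S \<subseteq> vs.span B" "card B = vs.dim (v ` S)"
    by (rule vs.basis_exists)
  from B(1) obtain T where T: "T \<subseteq> S" "inj_on v T" "B = v ` T"
    by (meson subset_image_inj)
  have finS: "finite S" "finite T" "finite B"
    using SJ J T finite_subset by (metis, metis, metis finite_imageI)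
  have "card T = card B" using T by (simp add: card_image)
  hence "T \<noteq> S" using B SJ by auto
  then obtain s where s: "s \<in> S" "s \<notin> T" using T(1) by auto
  have "\<not> v ` J \<subseteq> vs.span B"
    using vs.dim_le_card[of "v ` J" B] finS J(2) B(4) SJ(3) by auto
  then obtain l where l: "l \<in> J" "v l \<notin> vs.span B" by auto
  have "l \<notin> S" using l(2) B(3) by auto
  define S' where "S' = insert l (S - {s})"
  have S': "S' \<subseteq> J" "card S' = k"
    using SJ l s \<open>l \<notin> S\<close> finS k by (auto simp: S'_def card_insert_if card_Diff_singleton_if)
  have ind: "vs.independent (insert (v l) B)"
    using l(2) B(2) by (rule vs.independent_insertI)
  have "v l \<notin> B" using l(2) by (rule contrapos_nn) (rule vs.span_base)
  hence cB: "card (insert (v l) B) = vs.dim (v ` S) + 1" using finS B(4) by simp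
  have sub: "insert (v l) B \<subseteq> v ` S'" using T s by (auto simp: S'_def)
  obtain C where C: "C \<subseteq> v ` S'" "vs.independent C" "v ` S' \<subseteq> vs.span C" "card C = vs.dim (v ` S')"
    by (rule vs.basis_exists)
  have "finite C" using C(1) S' J finite_subset by (metis finite_imageI)
  hence "card (insert (v l) B) \<le> card C"
    using vs.independent_span_bound[OF _ ind, of C] sub C(3) by auto
  hence gt: "vs.dim (v ` S') > vs.dim (v ` S)" using cB C(4) by simp
  have "v ` S' \<subseteq> vs.span (insert (v l) B)"
    using B(3) vs.span_mono[of B "insert (v l) B"] vs.span_base[of "v l" "insert (v l) B"]
    by (auto simp: S'_def)
  hence "vs.dim (v ` S') \<le> card (insert (v l) B)"
    using finS by (intro vs.dim_le_card) auto
  hence "bad S'" using S' cB SJ(3) by (auto simp: bad_def)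
  with max gt show False by force
qed

lemma exists_MDS_of_bound:
  assumes nk: "k \<le> n" "k \<ge> 2" and j: "j \<ge> 7" and r: "r = 3 * j + 2"
  defines "\<rho> \<equiv> 4 / real (j + 1)"
  assumes small: "2 ^ (2 * n) * \<rho> ^ (2 * n - k) + real (2 * n choose k) * (4 * 4 ^ k * \<rho> ^ (k div 2)) < 1"
  shows "\<exists>A. (\<forall>i j. \<bar>A i j\<bar> \<le> int (2 * r ^ 6)) \<and> MDS k n A"
proof -
  define M where "M = 2 * r ^ 4 * r ^ 2"
  define px where "px = walk 4 M"
  define cX where "cX = Pi_pmf {..<k} 0 (\<lambda>_. px)"
  \<comment> \<open>Only the first n columns matter for \<open>MDS k n\<close>. The surplus serves
    the rank of the whole family, whose failure bound has exponent \<open>card J - k\<close>; with n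
    columns it would be void for n = k.\<close>
  define J where "J = {..<2 * n}"
  define z :: "nat \<Rightarrow> int" where "z = (\<lambda>_. 0)"
  let ?P = "\<lambda>J. Pi_pmf J z (\<lambda>_. cX)"
  let ?r = "\<lambda>y j. rvec (y j)"
  have rho: "0 < \<rho>" "\<rho> \<le> 1" using j by (auto simp: \<rho>_def)
  have "1 \<le> real r ^ 2" using r by simp
  hence "real r ^ 4 * 1 \<le> real r ^ 4 * (2 * real r ^ 2)" by (intro mult_left_mono) auto
  hence px: "pmf px y \<le> \<rho>" for y
    unfolding px_def M_def \<rho>_def using j r by (intro pmf_walk_bound) auto
  have finp: "finite (set_pmf px)" by (auto simp: px_def intro!: finite_set_walk)
  define E0 where "E0 = {x. vs.dim ((\<lambda>j. rvec (restr {..<k} (x j))) ` J) < card {..<k}}"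
  define E where "E S = {x. vs.dim (?r x ` S) = k - 1}" for S :: "nat set"
  define SS where "SS = {S. S \<subseteq> J \<and> card S = k}"
  have "finite SS" by (auto simp: SS_def J_def)
  have cardSS: "card SS = (2 * n) choose k"
    unfolding SS_def using n_subsets[of J k] by (simp add: J_def)
  have "measure_pmf.prob (?P J) (E0 \<union> (\<Union>S\<in>SS. E S)) \<le>
      measure_pmf.prob (?P J) E0 + measure_pmf.prob (?P J) (\<Union>S\<in>SS. E S)"
    by (intro measure_Un_le) auto
  also have "measure_pmf.prob (?P J) (\<Union>S\<in>SS. E S) \<le> (\<Sum>S\<in>SS. measure_pmf.prob (?P J) (E S))"
    using \<open>finite SS\<close> by (intro measure_pmf.finite_measure_subadditive_finite) auto
  also have "\<dots> \<le> (\<Sum>S\<in>SS. 4 * 4 ^ k * \<rho> ^ (k div 2))"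
  proof (rule sum_mono)
    fix S assume "S \<in> SS"
    hence S: "S \<subseteq> J" "card S = k" "finite S" by (auto simp: SS_def J_def finite_subset)
    have "?r (\<lambda>j. if j \<in> S then x j else z) ` S = ?r x ` S" for x by auto
    hence "measure_pmf.prob (?P S) (E S) = measure_pmf.prob (?P J) (E S)"
      using S(1) by (subst Pi_pmf_subset[of J S]) (auto simp: vimage_def E_def J_def)
    moreover have "measure_pmf.prob (?P S) (E S) \<le> 4 * 4 ^ k * \<rho> ^ (k div 2)"
      unfolding E_def cX_def px_def M_def \<rho>_def using S nk j r by (intro prob_rank_eq_le) auto
    ultimately show "measure_pmf.prob (?P J) (E S) \<le> 4 * 4 ^ k * \<rho> ^ (k div 2)" by simp
  qed
  also have "\<dots> = real (2 * n choose k) * (4 * 4 ^ k * \<rho> ^ (k div 2))" by (simp add: cardSS)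
  also have "measure_pmf.prob (?P J) E0 \<le> 2 ^ card J * \<rho> ^ (card J - card {..<k})"
    unfolding E0_def cX_def using finp px rho
    by (intro prob_rank_deficient_le) (auto simp: J_def)
  finally have "measure_pmf.prob (?P J) (E0 \<union> (\<Union>S\<in>SS. E S)) < 1"
    using small by (simp add: J_def)
  hence "\<not> set_pmf (?P J) \<subseteq> E0 \<union> (\<Union>S\<in>SS. E S)"
    using measure_pmf.prob_eq_1[of "E0 \<union> (\<Union>S\<in>SS. E S)" "?P J"] by (auto simp: AE_measure_pmf_iff)
  then obtain x where x: "x \<in> set_pmf (?P J)" "x \<notin> E0" "\<And>S. S \<in> SS \<Longrightarrow> x \<notin> E S" by auto
  have col: "x l \<in> set_pmf cX" if "l \<in> J" for l
    using x(1) that by (auto simp: set_Pi_pmf PiE_dflt_def J_def)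
  have xv: "rvec (x l) \<in> vecs {..<k}" if "l \<in> J" for l
    using col[OF that] unfolding cX_def by (rule rvec_in_vecs_Pi_pmf) simp
  have "restr {..<k} (x l) = x l" if "l \<in> J" for l
    using xv[OF that] by (auto simp: restr_def vecs_def rvec_def)
  hence "(\<lambda>j. rvec (restr {..<k} (x j))) ` J = ?r x ` J" by (intro image_cong) simp_all
  hence full: "vs.dim (?r x ` J) \<ge> k" using x(2) by (simp add: E0_def)
  have bases: "vs.dim (?r x ` S) \<ge> k" if "S \<subseteq> J" "card S = k" for S
  proof (rule all_bases_of_no_corank_one[OF _ full _ _ that])
    fix S' assume "S' \<subseteq> J" "card S' = k"
    thus "vs.dim (?r x ` S') \<noteq> k - 1" using x(3)[of S'] by (simp add: E_def SS_def)
  qed (use nk in \<open>simp_all add: J_def\<close>)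
  define A where "A i l = (if l \<in> J \<and> i < k then x l i else 0)" for i l
  have "\<bar>A i l\<bar> \<le> int (2 * r ^ 6)" for i l
  proof (cases "l \<in> J \<and> i < k")
    case True
    hence "x l i \<in> set_pmf px" using col[of l] by (auto simp: cX_def set_Pi_pmf PiE_dflt_def)
    hence "\<bar>x l i\<bar> \<le> int M" using set_walk[of 4 M] by (force simp: px_def)
    also have "M = 2 * r ^ 6" by (simp add: M_def mult.assoc flip: power_add)
    finally show ?thesis using True by (simp add: A_def)
  qed (auto simp: A_def)
  moreover have "MDS k n A"
    unfolding MDS_def
  proof (intro allI impI notI)
    fix c :: "nat \<Rightarrow> nat"
    assume c: "strict_mono_on {..<k} c \<and> c ` {..<k} \<subseteq> {..<n}"
      and "det_nat k (\<lambda>i j. real_of_int (A i (c j))) = 0"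
    from orth_columns_of_det_nat_0[OF this(2)] obtain a where
      a: "\<exists>i<k. a i \<noteq> 0" "\<And>l. l < k \<Longrightarrow> (\<Sum>i<k. a i * A i (c l)) = 0" by blast
    have cJ: "c l \<in> J" if "l < k" for l using c that by (fastforce simp: J_def image_subset_iff)
    have "inj_on c {..<k}" using c strict_mono_on_imp_inj_on by blast
    hence "vs.dim (?r x ` (c ` {..<k})) \<ge> k"
      using cJ by (intro bases) (auto simp: card_image)
    moreover from a(1) obtain i where i: "i < k" "a i \<noteq> 0" by blast
    have "vs.dim (?r x ` (c ` {..<k})) < card {..<k}"
    proof (rule dim_less_of_orth[where a = "\<lambda>i. real_of_int (a i)" and i = i])
      fix v assume "v \<in> ?r x ` (c ` {..<k})"
      then obtain l where l: "l < k" "v = rvec (x (c l))" by auto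
      have "0 = real_of_int (\<Sum>i<k. a i * A i (c l))" using a(2)[OF l(1)] by simp
      also have "\<dots> = (\<Sum>i<k. real_of_int (a i) * v i)"
        using cJ[OF l(1)] by (simp add: A_def l(2) rvec_def)
      finally show "(\<Sum>i<k. real_of_int (a i) * v i) = 0" by simp
    qed (use cJ xv i in auto)
    ultimately show False by simp
  qed
  ultimately show ?thesis by blast
qed

section \<open>Numerical estimates and choice of parameters\<close>

lemma power_self_le_fact: "real k ^ k \<le> 3 ^ k * fact k"
proof -
  have "(\<lambda>n. real k ^ n /\<^sub>R fact n) sums exp (real k)" by (rule exp_converges)
  hence "(\<Sum>n\<in>{k}. real k ^ n /\<^sub>R fact n) \<le> exp (real k)"
    by (intro sum_le_suminf[where f = "\<lambda>n. real k ^ n /\<^sub>R fact n", THEN order_trans])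
      (auto simp: sums_iff)
  also have "exp (real k) = exp 1 ^ k" by (simp add: exp_of_nat_mult[symmetric])
  also have "\<dots> \<le> 3 ^ k" using exp_le by (intro power_mono) auto
  finally show ?thesis by (simp add: field_simps)
qed

lemma binomial_le_power_ratio:
  assumes "k \<ge> 1"
  shows "real (n choose k) \<le> (3 * real n / real k) ^ k"
proof -
  have "real (n choose k) * real k ^ k \<le> real (n choose k) * (3 ^ k * fact k)"
    by (intro mult_left_mono power_self_le_fact) auto
  also have "\<dots> = 3 ^ k * real ((n choose k) * fact k)" by simp
  also have "\<dots> \<le> 3 ^ k * real (n ^ k)"
    by (intro mult_left_mono) (use binomial_fact_pow[of n k] in linarith, simp)
  finally show ?thesis using assms by (simp add: field_simps)
qed

lemma exists_MDS_of_large_m: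
  assumes nk: "k \<le> n" "k \<ge> 2" and m: "real m \<ge> (288 * (real n / real k)) ^ 18"
  shows "\<exists>A. (\<forall>i j. \<bar>A i j\<bar> \<le> int m) \<and> MDS k n A"
proof -
  define x where "x = real n / real k"
  have x: "x \<ge> 1" using nk by (simp add: x_def)
  define w where "w = nat \<lceil>4 * (96 * x) ^ 3\<rceil>"
  define j where "j = w - 1"
  define r where "r = 3 * j + 2"
  define \<rho> where "\<rho> = 4 / real (j + 1)"
  \<comment> \<open>Chosen so that 6x from the binomial coefficient, 4 from \<open>4 ^ k\<close> and
    \<beta> multiply to 1/4. The cube in w ensures \<rho> \<le> \<beta>^3, and then \<rho>^(k div 2)
    \<le> \<beta>^k, since 3 (k div 2) \<ge> k for k \<ge> 2.\<close>
  define \<beta> where "\<beta> = 1 / (96 * x)"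
  have "(96 * x) ^ 3 \<ge> 96 ^ 3" using x by (intro power_mono) auto
  hence X: "(96 * x) ^ 3 \<ge> 884736" by simp
  have w: "4 * (96 * x) ^ 3 \<le> real w" "real w \<le> 5 * (96 * x) ^ 3"
    unfolding w_def using X by linarith+
  have "real w \<ge> 64" using w(1) X by linarith
  hence w64: "w \<ge> 64" by linarith
  hence j: "j + 1 = w" "j \<ge> 7" by (auto simp: j_def)
  have rho: "0 < \<rho>" "\<rho> \<le> 1 / 16" unfolding \<rho>_def j(1) using w64 by (auto simp: field_simps)
  have beta: "0 < \<beta>" "\<beta> \<le> 1" "\<rho> \<le> \<beta> ^ 3"
  proof -
    have "\<rho> \<le> 4 / (4 * (96 * x) ^ 3)"
      unfolding \<rho>_def j(1) using w(1) w64 x by (intro divide_left_mono mult_pos_pos) auto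
    also have "\<dots> = \<beta> ^ 3" by (simp add: \<beta>_def power_divide)
    finally show "\<rho> \<le> \<beta> ^ 3" .
  qed (use x in \<open>auto simp: \<beta>_def\<close>)
  have "2 ^ (2 * n) * \<rho> ^ (2 * n - k) \<le> 2 ^ (2 * n) * \<rho> ^ n"
    using nk rho by (intro mult_left_mono power_decreasing) auto
  also have "\<dots> = (4 * \<rho>) ^ n" by (simp add: power_mult power_mult_distrib)
  also have "\<dots> \<le> (4 * \<rho>) ^ 1" using rho nk by (intro power_decreasing) auto
  also have "\<dots> \<le> 1 / 4" using rho by simp
  finally have t1: "2 ^ (2 * n) * \<rho> ^ (2 * n - k) \<le> 1 / 4" .
  have "real (2 * n choose k) * (4 * 4 ^ k * \<rho> ^ (k div 2)) \<le> (6 * x) ^ k * (4 * 4 ^ k * \<beta> ^ k)"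
  proof (intro mult_mono)
    show "real (2 * n choose k) \<le> (6 * x) ^ k"
      using binomial_le_power_ratio[of k "2 * n"] nk by (simp add: x_def)
    have "\<rho> ^ (k div 2) \<le> (\<beta> ^ 3) ^ (k div 2)" using rho beta by (intro power_mono) auto
    also have "\<dots> = \<beta> ^ (3 * (k div 2))" by (simp add: power_mult)
    also have "\<dots> \<le> \<beta> ^ k" using beta nk by (intro power_decreasing) auto
    finally show "\<rho> ^ (k div 2) \<le> \<beta> ^ k" .
  qed (use x rho in auto)
  also have "\<dots> = 4 * (6 * x * 4 * \<beta>) ^ k"
    by (simp only: power_mult_distrib mult_ac)
  also have "6 * x * 4 * \<beta> = 1 / 4" using x by (simp add: \<beta>_def)
  also have "4 * (1 / 4) ^ k \<le> 4 * (1 / 4 :: real) ^ 2"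
    using nk by (intro mult_left_mono power_decreasing) auto
  finally have t2: "real (2 * n choose k) * (4 * 4 ^ k * \<rho> ^ (k div 2)) \<le> 1 / 4" by (simp add: power2_eq_square)
  obtain A where A: "\<And>i l. \<bar>A i l\<bar> \<le> int (2 * r ^ 6)" "MDS k n A"
    using exists_MDS_of_bound[OF nk j(2) r_def] t1 t2 unfolding \<rho>_def by force
  have "real r \<le> 3 * real w" using j by (simp add: r_def)
  also have "\<dots> \<le> 15 * (96 * x) ^ 3" using w(2) by simp
  finally have "real r ^ 6 \<le> (15 * (96 * x) ^ 3) ^ 6" by (intro power_mono) auto
  \<comment> \<open>Entries have size 2 r^6 with r of order x^3, whence the exponent 18; the
    constant 2 * 15^6 fits under 3^18, which turns 96 into 288.\<close>
  hence "2 * real r ^ 6 \<le> 2 * 15 ^ 6 * (96 * x) ^ 18" by (simp add: power_mult_distrib flip: power_mult)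
  also have "\<dots> \<le> 3 ^ 18 * (96 * x) ^ 18" using x by (intro mult_right_mono) auto
  also have "\<dots> = (3 * (96 * x)) ^ 18" by (rule power_mult_distrib[symmetric])
  also have "\<dots> \<le> real m" using m by (simp add: x_def)
  finally have "int (2 * r ^ 6) \<le> int m"
    by (metis of_nat_le_iff of_nat_mult of_nat_numeral of_nat_power)
  with A show ?thesis by (meson order_trans)
qed

lemma MDS_one_row:
  assumes "\<And>l. l < n \<Longrightarrow> A 0 l \<noteq> 0"
  shows "MDS 1 n A"
proof -
  have "{p. p permutes {..<Suc 0}} = {id}"
    by (auto simp: lessThan_Suc permutes_sing permutes_id)
  thus ?thesis using assms by (auto simp: MDS_def det_nat_def sign_id)
qed

theorem theorem2:
  shows "\<exists>c::real. c > 0 \<and>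
    (\<forall>n k m :: nat. 1 \<le> k \<longrightarrow> k \<le> n \<longrightarrow> real m \<ge> (c * real n / real k) powr c \<longrightarrow>
      (\<exists>A :: nat \<Rightarrow> nat \<Rightarrow> int.
         (\<forall>i<k. \<forall>j<n. A i j \<in> {- int m .. int m}) \<and> MDS k n A))"
proof (intro exI[of _ "288 :: real"] conjI allI impI)
  fix n k m :: nat
  assume k: "1 \<le> k" "k \<le> n" and m: "(288 * real n / real k) powr 288 \<le> real m"
  define y where "y = 288 * real n / real k"
  have y: "y \<ge> 1" using k by (simp add: y_def field_simps)
  \<comment> \<open>The base needs 288, the exponent only 18; since y \<ge> 1, one constant can
    serve as both.\<close>
  have "y ^ 18 \<le> y ^ 288" using y by (intro power_increasing) auto
  also have "\<dots> = y powr 288" using y by (simp add: powr_numeral)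
  finally have m18: "y ^ 18 \<le> real m" using m by (simp add: y_def)
  show "\<exists>A. (\<forall>i<k. \<forall>j<n. A i j \<in> {- int m..int m}) \<and> MDS k n A"
  \<comment> \<open>For k = 1 the exponent \<open>k div 2\<close> is 0 and the random construction
    gives nothing; the all-ones row does, as m \<ge> 1.\<close>
  proof (cases "k = 1")
    case True
    have "1 \<le> y ^ 18" using y by (intro one_le_power)
    hence "m \<ge> 1" using m18 by linarith
    thus ?thesis unfolding True by (intro exI[of _ "\<lambda>_ _. 1"] conjI MDS_one_row) auto
  next
    case False
    hence "k \<ge> 2" using k by simp
    then obtain A where A: "\<And>i l. \<bar>A i l\<bar> \<le> int m" "MDS k n A"
      using exists_MDS_of_large_m[OF k(2), of m] m18 by (auto simp: y_def)
    hence "- int m \<le> A i l \<and> A i l \<le> int m" for i l using abs_le_iff[of "A i l"] by (metis minus_le_iff)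
    with A(2) show ?thesis by auto
  qed
qed simp

end
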